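(* Suppose that $f_X\in H_p$ for some $p>0$ and that $f_\epsilon$ is ordinary smooth with parameter $a>1/2$, i.e. there is a constant $d>0$ such that $d\le(1+t^2)^a|[\mathcal{F}f_\epsilon](t)|^2\le d^{-1}$ for all $t\in\mathbb{R}$. Let $\widehat{f_Y}$ be the kernel estimator constructed using a kernel $K\in\mathcal{K}_{p+a}$ and a bandwidth $h=c\,n^{-1/(2(p+a)+1)}$, $c>0$. For $0\le s<p$ consider the estimator $\widetilde{f_X}_s$ with threshold $\alpha=c'\,n^{-2(a+s)/(2(p+a)+1)}$, $c'>0$. Then $$\mathbb{E}\|\widetilde{f_X}_s-f_X\|_s^2=O\big(n^{-2(p-s)/(2(a+p)+1)}\big)\qquad\text{as }n\to\infty .$$
   Context: $\|\cdot\|$ is the norm of $L^2(\mathbb{R})$ and $[\mathcal{F}g](t)=\frac{1}{\sqrt{2\pi}}\int_{-\infty}^\infty e^{-itx}g(x)\,dx$ for $g\in L^1(\mathbb{R})\cap L^2(\mathbb{R})$, extended as a unitary operator to $L^2(\mathbb{R})$. $\mathcal{D}$ is the set of all probability densities in $L^2(\mathbb{R})$. $X$ and $\epsilon$ are independent real random variables with densities $f_X,f_\epsilon\in\mathcal{D}$, with $|[\mathcal{F}f_\epsilon](t)|^2>0$ for all $t\in\mathbb{R}$; $Y=X+\epsilon$ has density $f_Y=f_X\star f_\epsilon$ (convolution). The density $f_\epsilon$ is known and $Y_1,\dots,Y_n$ is an i.i.d. sample from $f_Y$. For $s\in\mathbb{R}$ let $\ell_s(t):=(1+t^2)^{s/2}$,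 and for $s\ge0$ let $\|f\|_s^2:=\int_{-\infty}^\infty(1+t^2)^s|[\mathcal{F}f](t)|^2\,dt$ and $H_s:=\{f\in L^2(\mathbb{R}):\|f\|_s<\infty\}$. The kernel estimator with kernel $K$ and bandwidth $h>0$ is $\widehat{f_Y}(y):=\frac1{nh}\sum_{j=1}^nK\big(\frac{Y_j-y}{h}\big)$, and for $r\ge0$ $$\mathcal{K}_r:=\Big\{K\in L^1(\mathbb{R})\cap L^2(\mathbb{R}):\lim_{t\to0}\frac{|1-\sqrt{2\pi}[\mathcal{F}K](t)|}{|t|^r}=\kappa_r<\infty\Big\}.$$ For a threshold $\alpha=\alpha(n)>0$ the estimator $\widetilde{f_X}_s$ is defined by $$\mathcal{F}\widetilde{f_X}_s:=\frac{\mathcal{F}\widehat{f_Y}\cdot\overline{\mathcal{F}f_\epsilon}}{\sqrt{2\pi}\,|\mathcal{F}f_\epsilon|^2}\cdot\mathbb{1}\{|\mathcal{F}f_\epsilon/\ell_s|^2\ge\alpha\}.$$ *)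

theory Defs
  imports "HOL-Probability.Probability"
begin

text \<open>Elements of the space of square integrable functions are represented by Borel functions;
  two representatives that agree almost everywhere are not identified.\<close>

definition L2 :: "(real \<Rightarrow> complex) set" where
  "L2 = {g. g \<in> borel_measurable borel \<and> integrable lborel (\<lambda>x. (cmod (g x))\<^sup>2)}"

definition L1 :: "(real \<Rightarrow> complex) set" where
  "L1 = {g. g \<in> borel_measurable borel \<and> integrable lborel g}"

definition L2_tendsto :: "(nat \<Rightarrow> real \<Rightarrow> complex) \<Rightarrow> (real \<Rightarrow> complex) \<Rightarrow> bool" where
  "L2_tendsto gs g \<longleftrightarrow> (\<lambda>n. LINT x|lborel. (cmod (gs n x - g x))\<^sup>2) \<longlonglongrightarrow> 0"

definition fourier_integral :: "(real \<Rightarrow> complex) \<Rightarrow> real \<Rightarrow> complex" where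
  "fourier_integral g t =
     complex_of_real (1 / sqrt (2 * pi)) *
     (LINT x|lborel. exp (- \<i> * complex_of_real t * complex_of_real x) * g x)"

text \<open>The graph of the continuous extension of \<^const>\<open>fourier_integral\<close> from the intersection of
  \<^const>\<open>L1\<close> and \<^const>\<open>L2\<close> to \<^const>\<open>L2\<close>; the transform is determined up to a null set.\<close>

definition is_fourier_L2 :: "(real \<Rightarrow> complex) \<Rightarrow> (real \<Rightarrow> complex) \<Rightarrow> bool" where
  "is_fourier_L2 g G \<longleftrightarrow> g \<in> L2 \<and> G \<in> L2 \<and>
     (\<exists>gs. (\<forall>n. gs n \<in> L1 \<inter> L2) \<and> L2_tendsto gs g \<and>
           L2_tendsto (\<lambda>n. fourier_integral (gs n)) G)"

text \<open>On integrable functions the transform is the integral at every point, so that conditions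
  required for all \<open>t\<close> are meaningful. Elsewhere a representative is chosen.\<close>

definition fourier :: "(real \<Rightarrow> complex) \<Rightarrow> real \<Rightarrow> complex" where
  "fourier g = (if g \<in> L1 then fourier_integral g else (SOME G. is_fourier_L2 g G))"

definition ell :: "real \<Rightarrow> real \<Rightarrow> real" where
  "ell s t = (1 + t\<^sup>2) powr (s / 2)"

definition sobolev_norm_sq :: "real \<Rightarrow> (real \<Rightarrow> complex) \<Rightarrow> ennreal" where
  "sobolev_norm_sq s g = (\<integral>\<^sup>+t. ennreal ((1 + t\<^sup>2) powr s * (cmod (fourier g t))\<^sup>2) \<partial>lborel)"

definition sobolev :: "real \<Rightarrow> (real \<Rightarrow> complex) set" where
  "sobolev s = {g \<in> L2. sobolev_norm_sq s g < \<infinity>}"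

definition densities_L2 :: "(real \<Rightarrow> real) set" where
  "densities_L2 = {f. f \<in> borel_measurable borel \<and> (\<forall>x. 0 \<le> f x) \<and>
     (\<integral>\<^sup>+x. ennreal (f x) \<partial>lborel) = 1 \<and> (\<lambda>x. complex_of_real (f x)) \<in> L2}"

definition density_convolution :: "(real \<Rightarrow> real) \<Rightarrow> (real \<Rightarrow> real) \<Rightarrow> real \<Rightarrow> real" where
  "density_convolution f g y = (LINT x|lborel. f x * g (y - x))"

definition ordinary_smooth :: "real \<Rightarrow> (real \<Rightarrow> real) \<Rightarrow> bool" where
  "ordinary_smooth a f \<longleftrightarrow> (\<exists>d>0. \<forall>t.
     d \<le> (1 + t\<^sup>2) powr a * (cmod (fourier (\<lambda>x. complex_of_real (f x)) t))\<^sup>2 \<and>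
     (1 + t\<^sup>2) powr a * (cmod (fourier (\<lambda>x. complex_of_real (f x)) t))\<^sup>2 \<le> inverse d)"

definition kernel_class :: "real \<Rightarrow> (real \<Rightarrow> complex) set" where
  "kernel_class r = {K \<in> L1 \<inter> L2. \<exists>\<kappa>::real.
     ((\<lambda>t. cmod (1 - complex_of_real (sqrt (2 * pi)) * fourier K t) / \<bar>t\<bar> powr r) \<longlongrightarrow> \<kappa>) (at 0)}"

text \<open>In the next two definitions \<open>y 1, \<dots>, y n\<close> are the observed values of the sample.\<close>

definition kernel_estimator ::
    "(real \<Rightarrow> complex) \<Rightarrow> real \<Rightarrow> nat \<Rightarrow> (nat \<Rightarrow> real) \<Rightarrow> real \<Rightarrow> complex" where
  "kernel_estimator K h n y z =
     complex_of_real (1 / (real n * h)) * (\<Sum>j=1..n. K ((y j - z) / h))"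

text \<open>The defining equation prescribes the transform of the estimator, hence determines the
  estimator up to a null set.\<close>

definition deconvolution_estimator ::
    "(real \<Rightarrow> complex) \<Rightarrow> (real \<Rightarrow> real) \<Rightarrow> real \<Rightarrow> real \<Rightarrow> real \<Rightarrow> nat \<Rightarrow> (nat \<Rightarrow> real) \<Rightarrow> real \<Rightarrow> complex"
  where
  "deconvolution_estimator K f\<epsilon> s h \<alpha> n y =
     (let \<phi> = fourier (\<lambda>x. complex_of_real (f\<epsilon> x)) in
      SOME g. g \<in> L2 \<and> (AE t in lborel. fourier g t =
        fourier (kernel_estimator K h n y) t * cnj (\<phi> t)
          / complex_of_real (sqrt (2 * pi) * (cmod (\<phi> t))\<^sup>2)
        * indicator {u. (cmod (\<phi> u / complex_of_real (ell s u)))\<^sup>2 \<ge> \<alpha>} t))"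

end

theory Submission
  imports Defs
begin

text \<open>
  The loss is evaluated on the Fourier side. Let \<open>\<psi>\<close> and \<open>\<phi>\<close> be the transforms of \<open>fX\<close> and
  \<open>f\<epsilon>\<close>, let \<open>A(t)\<close> be the mean of \<open>exp (-i t Y\<^sub>j)\<close> over the sample, and let \<open>m(t)\<close> be
  \<open>1 / (sqrt (2\<pi>) \<phi>(t))\<close> cut off to \<open>0\<close> where the threshold fails. The transform of the
  estimator is \<open>A(t) \<cdot> FK(-h t) \<cdot> m(t)\<close>, where \<open>FK\<close> is the transform of the kernel, and \<open>A(t)\<close> has
  expectation \<open>\<mu>(t) = 2\<pi> \<psi>(t) \<phi>(t)\<close>. The loss is the integral over \<open>t\<close> of \<open>(1 + t\<^sup>2) powr s\<close> times
  the squared distance to \<open>\<psi>(t)\<close>, and Tonelli's theorem reduces its expectation to estimates at each \<open>t\<close>: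

  \<^item> The fluctuation \<open>A(t) - \<mu>(t)\<close> has mean square at most \<open>1 / n\<close>
    (\<open>mean_square_deviation_of_sample_mean\<close>), and meeting the threshold bounds
    \<open>(1 + t\<^sup>2) powr s \<cdot> |m(t)|\<^sup>2\<close> by \<open>1 / (2\<pi> \<alpha>)\<close> (\<open>inversion_factor_weighted_bound\<close>). With
    Plancherel for \<open>K\<close> this contributes a multiple of \<open>1 / (n \<alpha> h)\<close>.
  \<^item> Where the threshold is met, the bias is \<open>\<psi>(t) (sqrt (2\<pi>) FK(-h t) - 1)\<close>, of order
    \<open>|\<psi>(t)| (h |t|) powr (p + a)\<close>. The upper bound on \<open>\<phi>\<close> shows that there
    \<open>(1 + t\<^sup>2) powr (a + s)\<close> is at most \<open>1 / (d \<alpha>)\<close>, so that the smoothness of \<open>fX\<close> leaves a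
    contribution of order \<open>h powr (2 (p + a)) / \<alpha>\<close>.
  \<^item> Where the threshold fails, the bias is \<open>-\<psi>(t)\<close>. The lower bound on \<open>\<phi>\<close> makes \<open>1 + t\<^sup>2\<close>
    large there, and lowering the weight exponent from \<open>p\<close> to \<open>s\<close> gains the factor
    \<open>(\<alpha> / d) powr ((p - s) / (a + s))\<close>.

  The two bias estimates are \<open>weighted_bias_bound\<close>, and \<open>risk_bound\<close> collects everything into a bound
  valid for all \<open>n\<close>, \<open>h\<close> and \<open>\<alpha>\<close>. For the prescribed \<open>h\<close> and \<open>\<alpha>\<close> its three terms are
  constant multiples of the same power of \<open>n\<close>.

  Evaluating the loss in this way presupposes that a function with the prescribed transform exists, and that the
  transform of a difference is the difference of the transforms up to a null set. This is the Plancherel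
  theory of the first four sections. Its core is the identity for bounded integrable functions
  (\<open>plancherel_bounded\<close>), obtained by testing the transform of the autocorrelation against wide Gaussians.
  Existence on the whole space follows by completeness (\<open>is_fourier_L2_exists\<close>), uniqueness from the isometry
  (\<open>is_fourier_L2_unique\<close>), and inversion from the multiplication formula (\<open>is_fourier_L2_inverse\<close>).
\<close>

section \<open>The Fourier integral of integrable functions\<close>

lemma measurable_cis [measurable]: "cis \<in> borel_measurable borel"
  by (intro borel_measurable_continuous_onI continuous_intros)

lemma measurable_cnj [measurable]: "cnj \<in> borel_measurable borel"
  by (intro borel_measurable_continuous_onI continuous_intros)

lemma fourier_integral_cis:
  "fourier_integral g t =
    complex_of_real (1 / sqrt (2 * pi)) * (LINT x|lborel. cis (- (t * x)) * g x)"
  by (simp add: fourier_integral_def cis_conv_exp mult_ac)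

lemma L1_iff: "f \<in> L1 \<longleftrightarrow> integrable lborel f"
  by (auto simp: L1_def dest: borel_measurable_integrable)

lemma integrable_cis_mult_iff [simp]:
  assumes [measurable]: "f \<in> borel_measurable borel"
  shows "integrable lborel (\<lambda>x. cis (b * x) * f x) \<longleftrightarrow> integrable lborel f"
    "integrable lborel (\<lambda>x. cis (- (b * x)) * f x) \<longleftrightarrow> integrable lborel f"
proof -
  have "integrable lborel (\<lambda>x. cis (b * x) * f x) \<longleftrightarrow> integrable lborel f" for b
    by (subst (1 2) integrable_norm_iff[symmetric]) (auto simp: norm_mult)
  from this[of b] this[of "-b"]
  show "integrable lborel (\<lambda>x. cis (b * x) * f x) \<longleftrightarrow> integrable lborel f"
    "integrable lborel (\<lambda>x. cis (- (b * x)) * f x) \<longleftrightarrow> integrable lborel f"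
    by simp_all
qed

lemma integrable_cis_mult:
  fixes f :: "real \<Rightarrow> complex"
  assumes "integrable lborel f"
  shows "integrable lborel (\<lambda>x. cis (b * x) * f x)" "integrable lborel (\<lambda>x. cis (- (b * x)) * f x)"
  using assms borel_measurable_integrable[OF assms] by auto

lemma norm_fourier_integral_le:
  "cmod (fourier_integral f t) \<le> (LINT x|lborel. cmod (f x)) / sqrt (2 * pi)"
proof -
  have "cmod (LINT x|lborel. cis (- (t * x)) * f x) \<le> (LINT x|lborel. cmod (cis (- (t * x)) * f x))"
    by (rule integral_norm_bound)
  also have "\<dots> = (LINT x|lborel. cmod (f x))"
    by (simp add: norm_mult)
  finally show ?thesis
    by (simp add: fourier_integral_cis norm_mult norm_divide divide_right_mono)
qed

lemma measurable_fourier_integral [measurable (raw)]: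
  assumes [measurable]: "f \<in> borel_measurable borel"
  shows "fourier_integral f \<in> borel_measurable borel"
proof -
  have "(\<lambda>t. LINT x|lborel. cis (- (t * x)) * f x) \<in> borel_measurable borel"
    by (rule lborel.borel_measurable_lebesgue_integral) measurable
  then show ?thesis
    unfolding fourier_integral_cis[abs_def] by measurable
qed

lemma fourier_integral_diff:
  assumes "integrable lborel f" "integrable lborel g"
  shows "fourier_integral (\<lambda>x. f x - g x) t = fourier_integral f t - fourier_integral g t"
  unfolding fourier_integral_cis right_diff_distrib
    Bochner_Integration.integral_diff[OF integrable_cis_mult(2)[OF assms(1)] integrable_cis_mult(2)[OF assms(2)]]
  by (simp add: algebra_simps)

definition L1_convolution :: "(real \<Rightarrow> complex) \<Rightarrow> (real \<Rightarrow> complex) \<Rightarrow> real \<Rightarrow> complex" where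
  "L1_convolution f g y = (LINT x|lborel. f x * g (y - x))"

text \<open>Applied to a function and its reflected conjugate, the convolution theorem gives the transform of
  the autocorrelation; applied to two densities it gives the characteristic function of the observations.\<close>

lemma
  assumes f: "integrable lborel f" and g: "integrable lborel g"
  shows integrable_convolution: "integrable lborel (L1_convolution f g)"
    and fourier_integral_convolution:
      "fourier_integral (L1_convolution f g) t
        = complex_of_real (sqrt (2 * pi)) * (fourier_integral f t * fourier_integral g t)"
proof -
  have [measurable]: "f \<in> borel_measurable borel" "g \<in> borel_measurable borel"
    using f g by (auto dest: borel_measurable_integrable)
  have g': "integrable lborel (\<lambda>y. g (y - x))" for x
    using lborel_integrable_real_affine[OF g, of 1 "-x"] by simp
  have shift: "(LINT y|lborel. h (y - x)) = (LINT y|lborel. h y)" for h :: "real \<Rightarrow> complex" and x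
    using lborel_integral_real_affine[of 1 h "-x"] by simp
  have shift_norm: "(LINT y|lborel. cmod (g (y - x))) = (LINT y|lborel. cmod (g y))" for x
    using lborel_integral_real_affine[of 1 "\<lambda>y. cmod (g y)" "-x"] by simp
  have int: "integrable (lborel \<Otimes>\<^sub>M lborel) (\<lambda>(x, y). f x * g (y - x))"
  proof (rule lborel_pair.Fubini_integrable)
    show "integrable lborel (\<lambda>x. LINT y|lborel. norm (case (x, y) of (x, y) \<Rightarrow> f x * g (y - x)))"
      using f by (simp add: norm_mult shift_norm)
    show "AE x in lborel. integrable lborel (\<lambda>y. case (x, y) of (x, y) \<Rightarrow> f x * g (y - x))"
      using g' by simp
  qed measurable
  show "integrable lborel (L1_convolution f g)"
    using lborel_pair.integrable_snd[OF int] by (simp add: L1_convolution_def[abs_def])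
  have int2: "integrable (lborel \<Otimes>\<^sub>M lborel) (\<lambda>(x, y). cis (- (t * y)) * (f x * g (y - x)))"
    using integrable_norm[OF int]
    by (subst integrable_norm_iff[symmetric]) (auto simp: norm_mult split_beta')
  have "(LINT y|lborel. cis (- (t * y)) * L1_convolution f g y)
      = (LINT y|lborel. LINT x|lborel. cis (- (t * y)) * (f x * g (y - x)))"
    by (simp add: L1_convolution_def)
  also have "\<dots> = (LINT x|lborel. LINT y|lborel. cis (- (t * y)) * (f x * g (y - x)))"
    using lborel_pair.Fubini_integral[OF int2] by simp
  also have "\<dots> = (LINT x|lborel. (cis (- (t * x)) * f x) * (LINT y|lborel. cis (- (t * (y - x))) * g (y - x)))"
    by (subst integral_mult_right_zero[symmetric], intro Bochner_Integration.integral_cong)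
       (auto simp: mult_ac cis_mult algebra_simps)
  also have "\<dots> = (LINT x|lborel. cis (- (t * x)) * f x) * (LINT y|lborel. cis (- (t * y)) * g y)"
    by (subst shift[of "\<lambda>y. cis (- (t * y)) * g y"]) simp
  finally show "fourier_integral (L1_convolution f g) t
      = complex_of_real (sqrt (2 * pi)) * (fourier_integral f t * fourier_integral g t)"
    by (simp add: fourier_integral_cis field_simps flip: of_real_mult)
qed

text \<open>Fubini, as the kernel \<open>cis (- (t * x))\<close> is symmetric in \<open>t\<close> and \<open>x\<close>. This moves the transform
  from one factor to the other, and so stands in for an inversion formula.\<close>

lemma fourier_integral_multiplication:
  assumes f: "integrable lborel f" and g: "integrable lborel g"
  shows "(LINT t|lborel. fourier_integral f t * g t) = (LINT x|lborel. f x * fourier_integral g x)"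
proof -
  have [measurable]: "f \<in> borel_measurable borel" "g \<in> borel_measurable borel"
    using f g by (auto dest: borel_measurable_integrable)
  have int: "integrable (lborel \<Otimes>\<^sub>M lborel) (\<lambda>(x, t). cis (- (t * x)) * (f x * g t))"
  proof (rule lborel_pair.Fubini_integrable)
    show "integrable lborel (\<lambda>x. LINT t|lborel. norm (case (x, t) of (x, t) \<Rightarrow> cis (- (t * x)) * (f x * g t)))"
      using f by (simp add: norm_mult)
    show "AE x in lborel. integrable lborel (\<lambda>t. case (x, t) of (x, t) \<Rightarrow> cis (- (t * x)) * (f x * g t))"
    proof (intro always_eventually allI)
      fix x
      have "integrable lborel (\<lambda>t. cis (- (x * t)) * (f x * g t))"
        using g by (intro integrable_cis_mult integrable_mult_right)
      then show "integrable lborel (\<lambda>t. case (x, t) of (x, t) \<Rightarrow> cis (- (t * x)) * (f x * g t))"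
        by (simp add: mult.commute)
    qed
  qed measurable
  have "(LINT t|lborel. (LINT x|lborel. cis (- (t * x)) * f x) * g t)
      = (LINT t|lborel. LINT x|lborel. cis (- (t * x)) * (f x * g t))"
    by (simp flip: integral_mult_left_zero add: mult.assoc)
  also have "\<dots> = (LINT x|lborel. LINT t|lborel. cis (- (t * x)) * (f x * g t))"
    using lborel_pair.Fubini_integral[OF int] by simp
  also have "\<dots> = (LINT x|lborel. f x * (LINT t|lborel. cis (- (x * t)) * g t))"
    by (simp flip: integral_mult_right_zero add: mult_ac)
  finally show ?thesis
    by (simp add: fourier_integral_cis mult_ac)
qed

text \<open>A rescaling of the characteristic function of the standard normal distribution.\<close>

lemma fourier_integral_gaussian:
  assumes "\<sigma> > 0"
  shows "fourier_integral (\<lambda>x. complex_of_real (exp (- (\<sigma> * x)\<^sup>2 / 2))) t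
    = complex_of_real (exp (- (t / \<sigma>)\<^sup>2 / 2) / \<sigma>)"
proof -
  have "complex_of_real (exp (- ((-t/\<sigma>)\<^sup>2) / 2)) = char std_normal_distribution (-t/\<sigma>)"
    by (simp add: char_std_normal_distribution)
  also have "\<dots> = (LINT x|lborel. std_normal_density x *\<^sub>R iexp (-t/\<sigma> * x))"
    unfolding char_def by (subst integral_density) auto
  also have "\<dots> = complex_of_real (1 / sqrt (2 * pi)) * (LINT x|lborel. cis (-(t/\<sigma> * x)) * complex_of_real (exp (- x\<^sup>2 / 2)))"
    by (subst integral_mult_right_zero[symmetric], intro Bochner_Integration.integral_cong)
       (auto simp: std_normal_density_def cis_conv_exp scaleR_conv_of_real mult_ac)
  also have "\<dots> = complex_of_real (1 / sqrt (2 * pi)) * (\<sigma> *\<^sub>R (LINT x|lborel. cis (-(t/\<sigma> * (0 + \<sigma> * x))) * complex_of_real (exp (- (0 + \<sigma> * x)\<^sup>2 / 2))))"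
    by (subst lborel_integral_real_affine[of \<sigma> _ 0]) (use assms in auto)
  also have "\<dots> = \<sigma> * fourier_integral (\<lambda>x. complex_of_real (exp (- (\<sigma> * x)\<^sup>2 / 2))) t"
    using assms by (simp add: fourier_integral_cis scaleR_conv_of_real)
  finally show ?thesis
    using assms by (simp add: field_simps)
qed

lemma integrable_gaussian:
  assumes "\<sigma> > 0"
  shows "integrable lborel (\<lambda>x. exp (- (\<sigma> * x)\<^sup>2 / 2) :: real)"
proof -
  have "integrable lborel std_normal_density"
    using integrable_normal_moment[of 1 0 0] by simp
  then have "integrable lborel (\<lambda>x. sqrt (2 * pi) * std_normal_density x)"
    by (rule integrable_mult_right)
  then have "integrable lborel (\<lambda>x. exp (- x\<^sup>2 / 2) :: real)"
    by (simp add: std_normal_density_def)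
  from lborel_integrable_real_affine[OF this, of \<sigma> 0] assms show ?thesis by simp
qed

section \<open>The Plancherel identity for bounded integrable functions\<close>

text \<open>For an open set \<open>U\<close> the claim is dominated convergence, since a point of \<open>U\<close> stays in \<open>U\<close> under
  small shifts. Outer regularity replaces \<open>A\<close> by an open \<open>U\<close> at the cost of the small measure of \<open>U - A\<close>.\<close>

lemma indicator_L1_translation_continuous:
  fixes A :: "real set" and v :: "nat \<Rightarrow> real"
  assumes A: "A \<in> sets lborel" "emeasure lborel A < \<infinity>" and v: "v \<longlonglongrightarrow> 0"
  shows "(\<lambda>n. LINT x|lborel. \<bar>indicator A (x - v n) - indicator A x\<bar>) \<longlonglongrightarrow> (0::real)"
proof (rule LIMSEQ_I)
  fix e :: real assume e: "e > 0"
  have [measurable]: "A \<in> sets borel" using A by simp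
  obtain U where U: "open U" "A \<subseteq> U" "(U - A) \<in> lmeasurable" "emeasure lebesgue (U - A) < ennreal (e / 4)"
    using sets_lebesgue_outer_open[of A "e / 4"] A e by auto
  have [measurable]: "U \<in> sets borel" using U by simp
  define D where "D = U - A"
  have [measurable]: "D \<in> sets borel" by (simp add: D_def)
  have eD: "emeasure lborel D < ennreal (e / 4)"
    using U(4) by (simp add: D_def)
  then have D: "emeasure lborel D < \<infinity>" using less_trans by fastforce
  have mD: "measure lborel D < e / 4"
  proof -
    have "ennreal (measure lborel D) < ennreal (e / 4)"
      using eD D by (subst emeasure_eq_ennreal_measure[symmetric]) auto
    then show ?thesis by (simp add: ennreal_less_iff)
  qed
  have "U = A \<union> D" using U(2) by (auto simp: D_def)
  then have eU: "emeasure lborel U < \<infinity>"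
    using emeasure_subadditive[of A lborel D] A(2) D by (auto simp: less_top[symmetric] top_unique)
  have shift: "(LINT x|lborel. h (x - w)) = (LINT x|lborel. h x)" for h :: "real \<Rightarrow> real" and w
    using lborel_integral_real_affine[of 1 h "-w"] by simp
  have shift': "integrable lborel (\<lambda>x. h (x - w))" if "integrable lborel h" for h :: "real \<Rightarrow> real" and w
    using lborel_integrable_real_affine[OF that, of 1 "-w"] by simp
  let ?i = "\<lambda>S. indicator S :: real \<Rightarrow> real"
  have iA: "integrable lborel (?i A)" and iU: "integrable lborel (?i U)" and iD: "integrable lborel (?i D)"
    using A eU D by auto
  \<comment> \<open>Openness makes the part of \<open>U\<close> lost by a small shift vanish pointwise.\<close>
  have "(\<lambda>n. LINT x|lborel. ?i U x * (1 - ?i U (x - v n))) \<longlonglongrightarrow> (LINT (x::real)|lborel. (0::real))"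
  proof (rule integral_dominated_convergence[where w = "?i U"])
    show "AE x in lborel. (\<lambda>n. ?i U x * (1 - ?i U (x - v n))) \<longlonglongrightarrow> 0"
    proof (intro always_eventually allI)
      fix x
      show "(\<lambda>n. ?i U x * (1 - ?i U (x - v n))) \<longlonglongrightarrow> 0"
      proof (cases "x \<in> U")
        case True
        have "(\<lambda>n. x - v n) \<longlonglongrightarrow> x" using tendsto_diff[OF tendsto_const v] by simp
        then have "\<forall>\<^sub>F n in sequentially. x - v n \<in> U"
          using U(1) True by (rule topological_tendstoD)
        then have "\<forall>\<^sub>F n in sequentially. ?i U x * (1 - ?i U (x - v n)) = 0"
          by eventually_elim auto
        then show ?thesis by (rule tendsto_eventually)
      qed simp
    qed
  qed (use iU in \<open>auto split: split_indicator\<close>)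
  then have "\<forall>\<^sub>F n in sequentially. (LINT x|lborel. ?i U x * (1 - ?i U (x - v n))) < e / 4"
    using e by (intro order_tendstoD(2)) auto
  then obtain N where N: "\<And>n. n \<ge> N \<Longrightarrow> (LINT x|lborel. ?i U x * (1 - ?i U (x - v n))) < e / 4"
    by (auto simp: eventually_sequentially)
  have "norm ((LINT x|lborel. \<bar>?i A (x - v n) - ?i A x\<bar>) - 0) < e" if "n \<ge> N" for n
  proof -
    have i1: "integrable lborel (\<lambda>x. ?i U x * (1 - ?i U (x - v n)))"
      by (rule Bochner_Integration.integrable_bound[OF iU]) (auto split: split_indicator)
    \<comment> \<open>For indicator values, \<open>\<bar>p - q\<bar> = p - q + 2 q (1 - p)\<close>. Shift invariance cancels \<open>p - q\<close>, so only
      the loss of \<open>U\<close> under the shift counts, not the gain.\<close>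
    have "(LINT x|lborel. \<bar>?i A (x - v n) - ?i A x\<bar>)
      \<le> (LINT x|lborel. ?i U (x - v n) - ?i U x + 2 * (?i U x * (1 - ?i U (x - v n))) + ?i D (x - v n) + ?i D x)"
      using U(2)
      by (intro integral_mono integrable_abs Bochner_Integration.integrable_diff
          Bochner_Integration.integrable_add integrable_mult_right shift' i1 iA iU iD)
         (auto simp: D_def split: split_indicator)
    also have "\<dots> = 2 * (LINT x|lborel. ?i U x * (1 - ?i U (x - v n))) + 2 * measure lborel D"
      using i1 iU iD shift'[OF iU] shift'[OF iD] shift[of "?i U"] shift[of "?i D"] by simp
    also have "\<dots> < e" using N[OF that] mD by simp
    finally show ?thesis by simp
  qed
  then show "\<exists>N. \<forall>n\<ge>N. norm ((LINT x|lborel. \<bar>?i A (x - v n) - ?i A x\<bar>) - 0) < e" by blast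
qed

text \<open>From indicators to integrable functions by linearity and density: the shift acts on \<open>L1\<close> by
  isometries, so approximation errors survive the shift unchanged.\<close>

lemma L1_translation_continuous:
  fixes f :: "real \<Rightarrow> complex" and v :: "nat \<Rightarrow> real"
  assumes "integrable lborel f" and v: "v \<longlonglongrightarrow> 0"
  shows "(\<lambda>n. LINT x|lborel. cmod (f (x - v n) - f x)) \<longlonglongrightarrow> 0"
  using assms(1)
proof (induction rule: integrable_induct)
  case (base A c)
  have "cmod (indicator A (x - w) *\<^sub>R c - indicator A x *\<^sub>R c)
      = \<bar>indicator A (x - w) - indicator A x\<bar> * cmod c" for x w :: real
    by (simp flip: scaleR_left_diff_distrib)
  then show ?case
    using tendsto_mult_right[OF indicator_L1_translation_continuous[OF base v], of "cmod c"] by simp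
next
  case (add f g)
  have sh: "integrable lborel (\<lambda>x. h (x - w))" if "integrable lborel h" for h :: "real \<Rightarrow> complex" and w
    using lborel_integrable_real_affine[OF that, of 1 "-w"] by simp
  have "\<forall>\<^sub>F n in sequentially. (LINT x|lborel. cmod ((f (x - v n) + g (x - v n)) - (f x + g x)))
     \<le> (LINT x|lborel. cmod (f (x - v n) - f x)) + (LINT x|lborel. cmod (g (x - v n) - g x))"
  proof (intro always_eventually allI)
    fix n
    have i: "integrable lborel (\<lambda>x. cmod (f (x - v n) - f x))" "integrable lborel (\<lambda>x. cmod (g (x - v n) - g x))"
      "integrable lborel (\<lambda>x. cmod ((f (x - v n) + g (x - v n)) - (f x + g x)))"
      by (intro integrable_norm Bochner_Integration.integrable_diff Bochner_Integration.integrable_add sh add(1,2))+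
    have "(LINT x|lborel. cmod ((f (x - v n) + g (x - v n)) - (f x + g x)))
     \<le> (LINT x|lborel. cmod (f (x - v n) - f x) + cmod (g (x - v n) - g x))"
    proof (intro integral_mono Bochner_Integration.integrable_add i)
      fix x
      show "cmod ((f (x - v n) + g (x - v n)) - (f x + g x)) \<le> cmod (f (x - v n) - f x) + cmod (g (x - v n) - g x)"
        using norm_triangle_ineq[of "f (x - v n) - f x" "g (x - v n) - g x"] by (simp add: algebra_simps)
    qed
    also have "\<dots> = (LINT x|lborel. cmod (f (x - v n) - f x)) + (LINT x|lborel. cmod (g (x - v n) - g x))"
      by (rule Bochner_Integration.integral_add[OF i(1,2)])
    finally show "(LINT x|lborel. cmod ((f (x - v n) + g (x - v n)) - (f x + g x)))
     \<le> (LINT x|lborel. cmod (f (x - v n) - f x)) + (LINT x|lborel. cmod (g (x - v n) - g x))" .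
  qed
  moreover have "(\<lambda>n. (LINT x|lborel. cmod (f (x - v n) - f x)) + (LINT x|lborel. cmod (g (x - v n) - g x)))
      \<longlonglongrightarrow> 0"
    using tendsto_add[OF add.IH] by simp
  ultimately show ?case
    by (rule tendsto_sandwich[OF always_eventually _ tendsto_const, rotated]) simp
next
  case (lim f s)
  have [measurable]: "f \<in> borel_measurable borel" "\<And>i. s i \<in> borel_measurable borel"
    using lim(1,4) by (auto dest: borel_measurable_integrable)
  have sh: "integrable lborel (\<lambda>x. h (x - w))" if "integrable lborel h" for h :: "real \<Rightarrow> complex" and w
    using lborel_integrable_real_affine[OF that, of 1 "-w"] by simp
  have shift: "(LINT x|lborel. h (x - w)) = (LINT x|lborel. h x)" for h :: "real \<Rightarrow> real" and w
    using lborel_integral_real_affine[of 1 h "-w"] by simp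
  have conv: "(\<lambda>i. LINT x|lborel. cmod (s i x - f x)) \<longlonglongrightarrow> (LINT (x::real)|lborel. (0::real))"
  proof (rule integral_dominated_convergence[where w = "\<lambda>x. 3 * cmod (f x)"])
    show "AE x in lborel. norm (cmod (s i x - f x)) \<le> 3 * cmod (f x)" for i
    proof (intro always_eventually allI)
      fix x
      have "cmod (s i x - f x) \<le> cmod (s i x) + cmod (f x)" by (rule norm_triangle_ineq4)
      then show "norm (cmod (s i x - f x)) \<le> 3 * cmod (f x)" using lim(3)[of x i] by simp
    qed
    show "AE x in lborel. (\<lambda>i. cmod (s i x - f x)) \<longlonglongrightarrow> 0"
      using lim(2) by (auto intro!: always_eventually tendsto_norm_zero simp: LIM_zero_iff)
  qed (use lim(4) in auto)
  show ?case
  proof (rule LIMSEQ_I)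
    fix e :: real assume e: "e > 0"
    then have "\<forall>\<^sub>F i in sequentially. (LINT x|lborel. cmod (s i x - f x)) < e / 4"
      using conv by (intro order_tendstoD(2)) auto
    then obtain i where i: "(LINT x|lborel. cmod (s i x - f x)) < e / 4"
      by (auto simp: eventually_sequentially)
    have "\<forall>\<^sub>F n in sequentially. (LINT x|lborel. cmod (s i (x - v n) - s i x)) < e / 4"
      using lim(5)[of i] e by (intro order_tendstoD(2)) auto
    then obtain N where N: "\<And>n. n \<ge> N \<Longrightarrow> (LINT x|lborel. cmod (s i (x - v n) - s i x)) < e / 4"
      by (auto simp: eventually_sequentially)
    have "norm ((LINT x|lborel. cmod (f (x - v n) - f x)) - 0) < e" if "n \<ge> N" for n
    proof -
      have i1: "integrable lborel (\<lambda>x. cmod (s i x - f x))"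
        and i2: "integrable lborel (\<lambda>x. cmod (s i (x - v n) - f (x - v n)))"
        and i3: "integrable lborel (\<lambda>x. cmod (s i (x - v n) - s i x))"
        and i4: "integrable lborel (\<lambda>x. cmod (f (x - v n) - f x))"
        by (auto intro!: integrable_norm Bochner_Integration.integrable_diff sh lim(1,4))
      have "(LINT x|lborel. cmod (f (x - v n) - f x))
        \<le> (LINT x|lborel. cmod (s i (x - v n) - f (x - v n)) + cmod (s i (x - v n) - s i x) + cmod (s i x - f x))"
      proof (intro integral_mono i1 i2 i3 i4 Bochner_Integration.integrable_add)
        fix x
        have "f (x - v n) - f x = - (s i (x - v n) - f (x - v n)) + (s i (x - v n) - s i x) + (s i x - f x)"
          by simp
        also have "cmod \<dots> \<le> cmod (- (s i (x - v n) - f (x - v n))) + cmod (s i (x - v n) - s i x) + cmod (s i x - f x)"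
          by (intro order_trans[OF norm_triangle_ineq] add_mono order_refl norm_triangle_ineq)
        finally show "cmod (f (x - v n) - f x)
          \<le> cmod (s i (x - v n) - f (x - v n)) + cmod (s i (x - v n) - s i x) + cmod (s i x - f x)"
          by (simp only: norm_minus_cancel)
      qed
      also have "\<dots> = 2 * (LINT x|lborel. cmod (s i x - f x)) + (LINT x|lborel. cmod (s i (x - v n) - s i x))"
        using i1 i2 i3 shift[of "\<lambda>x. cmod (s i x - f x)"] by simp
      also have "\<dots> < e" using i N[OF that] e by simp
      finally show ?thesis by simp
    qed
    then show "\<exists>N. \<forall>n\<ge>N. norm ((LINT x|lborel. cmod (f (x - v n) - f x)) - 0) < e" by blast
  qed
qed

lemma fourier_integral_reflected_cnj:
  "fourier_integral (\<lambda>x. cnj (f (- x))) t = cnj (fourier_integral f t)"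
proof -
  have "(LINT x|lborel. cis (- (t * x)) * cnj (f (- x))) = (LINT x|lborel. cnj (cis (- (t * x)) * f x))"
    by (subst lborel_integral_real_affine[of "-1" _ 0]) (simp_all add: cis_cnj)
  also have "\<dots> = cnj (LINT x|lborel. cis (- (t * x)) * f x)"
    by (rule Bochner_Integration.integral_cnj)
  finally show ?thesis
    by (simp add: fourier_integral_cis)
qed

text \<open>Let \<open>A w\<close> be the autocorrelation of \<open>R\<close>, so that \<open>A 0\<close> is the squared norm of \<open>R\<close> and the transform
  of \<open>A\<close> is \<open>sqrt (2\<pi>)\<close> times the squared modulus of the transform of \<open>R\<close>. Integrated against a Gaussian of
  width \<open>1 / \<sigma>\<close>, the latter becomes, by the multiplication formula, an average of \<open>A\<close> over a Gaussian of width
  \<open>\<sigma>\<close>. As \<open>\<sigma>\<close> tends to \<open>0\<close>, monotone convergence applies on one side and continuity of \<open>A\<close> at \<open>0\<close> on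
  the other. Boundedness of \<open>R\<close> reduces that continuity to continuity of translation in \<open>L1\<close>.\<close>

lemma
  assumes R: "integrable lborel R" and B: "\<And>x. cmod (R x) \<le> B"
  shows integrable_norm_sq_fourier_integral_bounded: "integrable lborel (\<lambda>t. (cmod (fourier_integral R t))\<^sup>2)"
    and plancherel_bounded:
      "(LINT t|lborel. (cmod (fourier_integral R t))\<^sup>2) = (LINT x|lborel. (cmod (R x))\<^sup>2)"
proof -
  have [measurable]: "R \<in> borel_measurable borel"
    using R by (auto dest: borel_measurable_integrable)
  define R' where "R' = (\<lambda>x. cnj (R (- x)))"
  define A where "A = L1_convolution R R'"
  have R': "integrable lborel R'"
    using lborel_integrable_real_affine[OF R, of "-1" 0] by (simp add: R'_def)
  have A: "integrable lborel A"
    unfolding A_def by (rule integrable_convolution[OF R R'])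
  then have [measurable]: "A \<in> borel_measurable borel" by (auto dest: borel_measurable_integrable)
  have FA: "fourier_integral A t = complex_of_real (sqrt (2 * pi) * (cmod (fourier_integral R t))\<^sup>2)" for t
    unfolding A_def fourier_integral_convolution[OF R R']
    by (simp add: R'_def fourier_integral_reflected_cnj complex_norm_square del: of_real_power)
  have prod_bound: "cmod (R x) * cmod (R y) \<le> B * cmod (R x)" for x y
    using mult_left_mono[OF B norm_ge_zero[of "R x"], of y] by (simp add: mult.commute)
  have prod_int: "integrable lborel (\<lambda>x. R x * cnj (R (x - w)))" for w
  proof -
    have "integrable lborel (\<lambda>x. B * cmod (R x))" using R by simp
    then show ?thesis
    proof (rule Bochner_Integration.integrable_bound)
      show "AE x in lborel. norm (R x * cnj (R (x - w))) \<le> norm (B * cmod (R x))"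
        using prod_bound order_trans[OF norm_ge_zero B] by (simp add: norm_mult)
    qed measurable
  qed
  have Adef: "A w = (LINT x|lborel. R x * cnj (R (x - w)))" for w
    by (simp add: A_def L1_convolution_def R'_def)
  have A0: "A 0 = complex_of_real (LINT x|lborel. (cmod (R x))\<^sup>2)"
    by (simp add: Adef flip: complex_norm_square of_real_power)
  have Abound: "cmod (A w) \<le> B * (LINT x|lborel. cmod (R x))" for w
  proof -
    have "cmod (A w) \<le> (LINT x|lborel. cmod (R x * cnj (R (x - w))))"
      unfolding Adef by (rule integral_norm_bound)
    also have "\<dots> \<le> (LINT x|lborel. B * cmod (R x))"
      using R by (intro integral_mono integrable_norm prod_int)
         (use prod_bound in \<open>auto simp: norm_mult\<close>)
    finally show ?thesis by simp
  qed
  have Acont: "(\<lambda>n. A (v n)) \<longlonglongrightarrow> A 0" if v: "v \<longlonglongrightarrow> 0" for v :: "nat \<Rightarrow> real"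
  proof -
    have "cmod (A w - A 0) \<le> (LINT x|lborel. cmod (R (x - w) - R x)) * B" for w
    proof -
      have sh: "integrable lborel (\<lambda>x. R (x - w))"
        using lborel_integrable_real_affine[OF R, of 1 "-w"] by simp
      have "A w - A 0 = (LINT x|lborel. R x * cnj (R (x - w)) - R x * cnj (R (x - 0)))"
        unfolding Adef by (rule Bochner_Integration.integral_diff[symmetric]) (rule prod_int)+
      also have "cmod \<dots> \<le> (LINT x|lborel. cmod (R x * cnj (R (x - w)) - R x * cnj (R (x - 0))))"
        by (rule integral_norm_bound)
      also have "\<dots> \<le> (LINT x|lborel. cmod (R (x - w) - R x) * B)"
      proof (intro integral_mono integrable_norm Bochner_Integration.integrable_diff prod_int
          integrable_mult_left sh R)
        fix x
        have "R x * cnj (R (x - w)) - R x * cnj (R (x - 0)) = R x * cnj (R (x - w) - R x)"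
          by (simp add: algebra_simps)
        also have "cmod \<dots> = cmod (R (x - w) - R x) * cmod (R x)"
          by (simp add: norm_mult del: complex_cnj_diff)
        also have "\<dots> \<le> cmod (R (x - w) - R x) * B" by (intro mult_left_mono B) simp
        finally show "cmod (R x * cnj (R (x - w)) - R x * cnj (R (x - 0))) \<le> cmod (R (x - w) - R x) * B" .
      qed
      finally show ?thesis by simp
    qed
    moreover have "(\<lambda>n. (LINT x|lborel. cmod (R (x - v n) - R x)) * B) \<longlonglongrightarrow> 0"
      using tendsto_mult_right[OF L1_translation_continuous[OF R v], of B] by simp
    ultimately have "(\<lambda>n. A (v n) - A 0) \<longlonglongrightarrow> 0"
      by (intro Lim_null_comparison[of "\<lambda>n. A (v n) - A 0"]) (auto intro!: always_eventually)
    then show ?thesis by (simp add: LIM_zero_iff)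
  qed
  define \<sigma> where "\<sigma> n = inverse (real (Suc n))" for n
  have \<sigma>: "\<sigma> n > 0" "\<sigma> \<longlonglongrightarrow> 0" for n
    unfolding \<sigma>_def using LIMSEQ_inverse_real_of_nat by auto
  define \<gamma> where "\<gamma> s x = complex_of_real (exp (- (s * x)\<^sup>2 / 2))" for s x :: real
  have g: "integrable lborel (\<gamma> s)" if "s > 0" for s
    unfolding \<gamma>_def by (intro integrable_of_real integrable_gaussian that)
  have Fg: "fourier_integral (\<gamma> s) x = \<gamma> (1 / s) x / s" if "s > 0" for s x
    unfolding \<gamma>_def[abs_def] fourier_integral_gaussian[OF that] by simp
  \<comment> \<open>The multiplication formula moves the Gaussian weight onto the autocorrelation,
    where it concentrates at the origin.\<close>
  have key: "(LINT t|lborel. fourier_integral A t * \<gamma> s t) = (LINT z|lborel. A (s * z) * \<gamma> 1 z)"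
    if s: "s > 0" for s
  proof -
    have "(LINT t|lborel. fourier_integral A t * \<gamma> s t) = (LINT x|lborel. A x * (\<gamma> (1 / s) x / s))"
      using fourier_integral_multiplication[OF A g[OF s]] by (simp add: Fg[OF s])
    also have "\<dots> = s *\<^sub>R (LINT z|lborel. A (0 + s * z) * (\<gamma> (1 / s) (0 + s * z) / s))"
      by (subst lborel_integral_real_affine[of s _ 0]) (use s in auto)
    also have "\<dots> = (LINT z|lborel. s *\<^sub>R (A (0 + s * z) * (\<gamma> (1 / s) (0 + s * z) / s)))"
      by simp
    also have "\<dots> = (LINT z|lborel. A (s * z) * \<gamma> 1 z)"
      using s by (intro Bochner_Integration.integral_cong) (auto simp: \<gamma>_def scaleR_conv_of_real)
    finally show ?thesis .
  qed
  have int1: "(LINT z|lborel. \<gamma> 1 z) = complex_of_real (sqrt (2 * pi))"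
    using fourier_integral_gaussian[of 1 0] by (simp add: fourier_integral_cis \<gamma>_def field_simps)
  have [measurable]: "\<gamma> s \<in> borel_measurable borel" for s unfolding \<gamma>_def[abs_def] by measurable
  have "(\<lambda>n. LINT z|lborel. A (\<sigma> n * z) * \<gamma> 1 z) \<longlonglongrightarrow> (LINT z|lborel. A 0 * \<gamma> 1 z)"
  proof (rule integral_dominated_convergence[where w = "\<lambda>z. B * (LINT x|lborel. cmod (R x)) * cmod (\<gamma> 1 z)"])
    show "integrable lborel (\<lambda>z. B * (LINT x|lborel. cmod (R x)) * cmod (\<gamma> 1 z))"
      using g[of 1] by simp
    show "AE z in lborel. (\<lambda>n. A (\<sigma> n * z) * \<gamma> 1 z) \<longlonglongrightarrow> A 0 * \<gamma> 1 z"
      by (intro always_eventually allI tendsto_mult tendsto_const Acont)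
         (use tendsto_mult_right[OF \<sigma>(2)] in simp)
    show "AE z in lborel. cmod (A (\<sigma> n * z) * \<gamma> 1 z) \<le> B * (LINT x|lborel. cmod (R x)) * cmod (\<gamma> 1 z)" for n
      unfolding norm_mult by (intro always_eventually allI mult_right_mono Abound) auto
  qed measurable
  then have "(\<lambda>n. LINT t|lborel. fourier_integral A t * \<gamma> (\<sigma> n) t) \<longlonglongrightarrow> A 0 * complex_of_real (sqrt (2 * pi))"
    by (simp add: key \<sigma>(1) int1)
  then have "(\<lambda>n. LINT t|lborel. complex_of_real (sqrt (2 * pi) * ((cmod (fourier_integral R t))\<^sup>2 * exp (- (\<sigma> n * t)\<^sup>2 / 2))))
      \<longlonglongrightarrow> complex_of_real ((LINT x|lborel. (cmod (R x))\<^sup>2) * sqrt (2 * pi))"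
    unfolding FA A0 \<gamma>_def of_real_mult mult.assoc .
  then have "(\<lambda>n. sqrt (2 * pi) * (LINT t|lborel. (cmod (fourier_integral R t))\<^sup>2 * exp (- (\<sigma> n * t)\<^sup>2 / 2)))
      \<longlonglongrightarrow> (LINT x|lborel. (cmod (R x))\<^sup>2) * sqrt (2 * pi)"
    unfolding integral_complex_of_real tendsto_of_real_iff Bochner_Integration.integral_mult_right_zero .
  from tendsto_mult_left[OF this, of "1 / sqrt (2 * pi)"]
  have lim: "(\<lambda>n. LINT t|lborel. (cmod (fourier_integral R t))\<^sup>2 * exp (- (\<sigma> n * t)\<^sup>2 / 2))
      \<longlonglongrightarrow> (LINT x|lborel. (cmod (R x))\<^sup>2)"
    by simp
  have int: "integrable lborel (\<lambda>t. (cmod (fourier_integral R t))\<^sup>2 * exp (- (\<sigma> n * t)\<^sup>2 / 2))" for n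
  proof -
    let ?c = "(LINT x|lborel. cmod (R x)) / sqrt (2 * pi)"
    have "integrable lborel (\<lambda>t. ?c\<^sup>2 * exp (- (\<sigma> n * t)\<^sup>2 / 2))"
      by (intro integrable_mult_right integrable_gaussian \<sigma>)
    then show ?thesis
      by (rule Bochner_Integration.integrable_bound)
         (auto intro!: mult_right_mono power_mono norm_fourier_integral_le simp: abs_mult)
  qed
  have mono: "AE t in lborel. mono (\<lambda>n. (cmod (fourier_integral R t))\<^sup>2 * exp (- (\<sigma> n * t)\<^sup>2 / 2))"
  proof (intro always_eventually allI monoI mult_left_mono)
    fix t and m n :: nat assume "m \<le> n"
    then have "\<sigma> n \<le> \<sigma> m" by (simp add: \<sigma>_def)
    then have "(\<sigma> n * t)\<^sup>2 \<le> (\<sigma> m * t)\<^sup>2"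
      unfolding power_mult_distrib using \<sigma>(1)[of n] by (intro mult_right_mono power_mono) auto
    then show "exp (- (\<sigma> m * t)\<^sup>2 / 2) \<le> exp (- (\<sigma> n * t)\<^sup>2 / 2)" by simp
  qed simp
  have ptw: "AE t in lborel. (\<lambda>n. (cmod (fourier_integral R t))\<^sup>2 * exp (- (\<sigma> n * t)\<^sup>2 / 2))
      \<longlonglongrightarrow> (cmod (fourier_integral R t))\<^sup>2"
  proof (intro always_eventually allI)
    fix t
    have "(\<lambda>n. (cmod (fourier_integral R t))\<^sup>2 * exp (- (\<sigma> n * t)\<^sup>2 / 2))
        \<longlonglongrightarrow> (cmod (fourier_integral R t))\<^sup>2 * exp (- (0 * t)\<^sup>2 / 2)"
      by (intro tendsto_intros \<sigma>) simp
    then show "(\<lambda>n. (cmod (fourier_integral R t))\<^sup>2 * exp (- (\<sigma> n * t)\<^sup>2 / 2))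
      \<longlonglongrightarrow> (cmod (fourier_integral R t))\<^sup>2" by simp
  qed
  note * = int mono _ ptw lim
  show "integrable lborel (\<lambda>t. (cmod (fourier_integral R t))\<^sup>2)"
    by (rule integral_monotone_convergence_nonneg(1)[OF *]) auto
  show "(LINT t|lborel. (cmod (fourier_integral R t))\<^sup>2) = (LINT x|lborel. (cmod (R x))\<^sup>2)"
    by (rule integral_monotone_convergence_nonneg(2)[OF *]) auto
qed

section \<open>Square integrable functions\<close>

definition sq_norm :: "(real \<Rightarrow> complex) \<Rightarrow> real" where
  "sq_norm f = (LINT x|lborel. (cmod (f x))\<^sup>2)"

lemma L2_tendsto_iff_sq_norm: "L2_tendsto gs g \<longleftrightarrow> (\<lambda>n. sq_norm (\<lambda>x. gs n x - g x)) \<longlonglongrightarrow> 0"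
  by (simp add: L2_tendsto_def sq_norm_def)

lemma sq_norm_nonneg [simp]: "0 \<le> sq_norm f"
  by (simp add: sq_norm_def)

lemma L2_measurable: "f \<in> L2 \<Longrightarrow> f \<in> borel_measurable borel"
  by (simp add: L2_def)

lemma L2_integrable: "f \<in> L2 \<Longrightarrow> integrable lborel (\<lambda>x. (cmod (f x))\<^sup>2)"
  by (simp add: L2_def)

lemma norm_diff_sq_le:
  fixes a b :: "'a::real_normed_vector"
  shows "(norm (a - b))\<^sup>2 \<le> 2 * (norm a)\<^sup>2 + 2 * (norm b)\<^sup>2"
proof -
  have "(norm (a - b))\<^sup>2 \<le> (norm a + norm b)\<^sup>2"
    by (intro power_mono norm_triangle_ineq4) simp
  also have "\<dots> \<le> 2 * (norm a)\<^sup>2 + 2 * (norm b)\<^sup>2"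
    using sum_squares_bound[of "norm a" "norm b"] by (simp add: power2_sum)
  finally show ?thesis .
qed

lemma L2_diff:
  assumes f: "f \<in> L2" and g: "g \<in> L2"
  shows "(\<lambda>x. f x - g x) \<in> L2"
proof -
  note [measurable] = L2_measurable[OF f] L2_measurable[OF g]
  have "integrable lborel (\<lambda>x. 2 * (cmod (f x))\<^sup>2 + 2 * (cmod (g x))\<^sup>2)"
    using f g by (auto simp: L2_def)
  then have "integrable lborel (\<lambda>x. (cmod (f x - g x))\<^sup>2)"
    by (rule Bochner_Integration.integrable_bound) (auto simp: norm_diff_sq_le)
  then show ?thesis by (simp add: L2_def)
qed

lemma sq_norm_diff_le:
  assumes f: "f \<in> L2" and g: "g \<in> L2"
  shows "sq_norm (\<lambda>x. f x - g x) \<le> 2 * sq_norm f + 2 * sq_norm g"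
proof -
  have "sq_norm (\<lambda>x. f x - g x) \<le> (LINT x|lborel. 2 * (cmod (f x))\<^sup>2 + 2 * (cmod (g x))\<^sup>2)"
    unfolding sq_norm_def
    by (intro integral_mono L2_integrable L2_diff f g norm_diff_sq_le
        Bochner_Integration.integrable_add integrable_mult_right)
  also have "\<dots> = 2 * sq_norm f + 2 * sq_norm g"
    using L2_integrable[OF f] L2_integrable[OF g] by (simp add: sq_norm_def)
  finally show ?thesis .
qed

lemma sq_norm_diff_commute: "sq_norm (\<lambda>x. f x - g x) = sq_norm (\<lambda>x. g x - f x)"
  by (simp add: sq_norm_def norm_minus_commute)

lemma L2_mult_integrable:
  assumes f: "f \<in> L2" and g: "g \<in> L2"
  shows "integrable lborel (\<lambda>x. f x * g x)"
proof -
  note [measurable] = L2_measurable[OF f] L2_measurable[OF g]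
  have "integrable lborel (\<lambda>x. (cmod (f x))\<^sup>2 + (cmod (g x))\<^sup>2)"
    using f g by (auto simp: L2_def)
  then show ?thesis
  proof (rule Bochner_Integration.integrable_bound)
    have "cmod (f x) * cmod (g x) \<le> (cmod (f x))\<^sup>2 + (cmod (g x))\<^sup>2" for x
    proof -
      have "2 * (cmod (f x) * cmod (g x)) \<le> (cmod (f x))\<^sup>2 + (cmod (g x))\<^sup>2"
        using sum_squares_bound[of "cmod (f x)" "cmod (g x)"] by (simp add: mult_ac)
      moreover have "0 \<le> cmod (f x) * cmod (g x)" by simp
      ultimately show ?thesis by linarith
    qed
    then show "AE x in lborel. norm (f x * g x) \<le> norm ((cmod (f x))\<^sup>2 + (cmod (g x))\<^sup>2)"
      by (auto simp: norm_mult)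
  qed measurable
qed

text \<open>The inequality \<open>2uv \<le> u\<^sup>2 / \<delta> + \<delta> v\<^sup>2\<close> with a small fixed \<open>\<delta>\<close> bounds the difference of the
  squared norms by a multiple of the squared distance plus an arbitrarily small constant.\<close>

lemma sq_norm_tendsto:
  assumes gs: "\<And>n. gs n \<in> L2" and g: "g \<in> L2" and lim: "L2_tendsto gs g"
  shows "(\<lambda>n. sq_norm (gs n)) \<longlonglongrightarrow> sq_norm g"
proof (rule LIMSEQ_I)
  fix e :: real assume e: "e > 0"
  \<comment> \<open>The summand \<open>1\<close> keeps the quotient defined when \<open>g\<close> vanishes.\<close>
  define \<delta> where "\<delta> = e / (2 * (sq_norm g + 1))"
  have \<delta>: "\<delta> > 0" unfolding \<delta>_def using e by (intro divide_pos_pos) (auto intro: add_nonneg_pos)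
  have \<delta>g: "\<delta> * sq_norm g < e / 2"
  proof -
    have "sq_norm g + 1 > 0" by (simp add: add_nonneg_pos)
    moreover have "e * sq_norm g < e * (sq_norm g + 1)" using e by simp
    ultimately show ?thesis by (simp add: \<delta>_def divide_simps) (simp add: algebra_simps)
  qed
  have ptw: "\<bar>(cmod a)\<^sup>2 - (cmod b)\<^sup>2\<bar> \<le> (1 + 1 / \<delta>) * (cmod (a - b))\<^sup>2 + \<delta> * (cmod b)\<^sup>2" for a b
  proof -
    let ?u = "cmod (a - b)" and ?v = "cmod b"
    have tri: "\<bar>cmod a - ?v\<bar> \<le> ?u" by (rule norm_triangle_ineq3)
    have "\<bar>(cmod a)\<^sup>2 - ?v\<^sup>2\<bar> = \<bar>cmod a - ?v\<bar> * (cmod a + ?v)"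
      by (simp add: power2_eq_square square_diff_square_factored abs_mult)
    also have "\<dots> \<le> ?u * (?u + 2 * ?v)"
      using tri by (intro mult_mono) auto
    also have "\<dots> = ?u\<^sup>2 + 2 * ?u * ?v" by (simp add: power2_eq_square algebra_simps)
    also have "2 * ?u * ?v \<le> 1 / \<delta> * ?u\<^sup>2 + \<delta> * ?v\<^sup>2"
    proof -
      have "0 \<le> (?u - \<delta> * ?v)\<^sup>2 / \<delta>" using \<delta> by simp
      also have "\<dots> = 1 / \<delta> * ?u\<^sup>2 + \<delta> * ?v\<^sup>2 - 2 * ?u * ?v"
        using \<delta> by (simp add: power2_diff field_simps power2_eq_square)
      finally show ?thesis by simp
    qed
    finally show ?thesis by (simp add: algebra_simps)
  qed
  have main: "\<bar>sq_norm (gs n) - sq_norm g\<bar> \<le> (1 + 1 / \<delta>) * sq_norm (\<lambda>x. gs n x - g x) + \<delta> * sq_norm g" for n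
  proof -
    note i = L2_integrable[OF gs[of n]] L2_integrable[OF g] L2_integrable[OF L2_diff[OF gs[of n] g]]
    have "sq_norm (gs n) - sq_norm g = (LINT x|lborel. (cmod (gs n x))\<^sup>2 - (cmod (g x))\<^sup>2)"
      using i by (simp add: sq_norm_def)
    also have "\<bar>\<dots>\<bar> \<le> (LINT x|lborel. \<bar>(cmod (gs n x))\<^sup>2 - (cmod (g x))\<^sup>2\<bar>)"
      by (rule integral_abs_bound)
    also have "\<dots> \<le> (LINT x|lborel. (1 + 1 / \<delta>) * (cmod (gs n x - g x))\<^sup>2 + \<delta> * (cmod (g x))\<^sup>2)"
      by (intro integral_mono ptw integrable_abs Bochner_Integration.integrable_diff
          Bochner_Integration.integrable_add integrable_mult_right i)
    also have "\<dots> = (1 + 1 / \<delta>) * sq_norm (\<lambda>x. gs n x - g x) + \<delta> * sq_norm g"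
      using i by (simp add: sq_norm_def)
    finally show ?thesis .
  qed
  have "(\<lambda>n. (1 + 1 / \<delta>) * sq_norm (\<lambda>x. gs n x - g x)) \<longlonglongrightarrow> 0"
    using tendsto_mult_left[OF lim[unfolded L2_tendsto_iff_sq_norm], of "1 + 1 / \<delta>"] by simp
  then have "\<forall>\<^sub>F n in sequentially. (1 + 1 / \<delta>) * sq_norm (\<lambda>x. gs n x - g x) < e / 2"
    using e by (intro order_tendstoD(2)) auto
  then have "\<forall>\<^sub>F n in sequentially. norm (sq_norm (gs n) - sq_norm g) < e"
  proof eventually_elim
    case (elim n)
    then show ?case unfolding real_norm_def using main[of n] \<delta>g by linarith
  qed
  then show "\<exists>N. \<forall>n\<ge>N. norm (sq_norm (gs n) - sq_norm g) < e"
    by (simp add: eventually_sequentially)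
qed

lemma tendsto_0_squeeze:
  fixes f g :: "nat \<Rightarrow> real"
  assumes "g \<longlonglongrightarrow> 0" and "\<And>n. 0 \<le> f n" and "\<And>n. f n \<le> g n"
  shows "f \<longlonglongrightarrow> 0"
  by (rule tendsto_sandwich[OF always_eventually always_eventually tendsto_const assms(1)])
     (use assms in auto)

lemma L2_tendsto_diff:
  assumes "\<And>n. fs n \<in> L2" "f \<in> L2" "L2_tendsto fs f"
    and "\<And>n. gs n \<in> L2" "g \<in> L2" "L2_tendsto gs g"
  shows "L2_tendsto (\<lambda>n x. fs n x - gs n x) (\<lambda>x. f x - g x)"
proof -
  have "sq_norm (\<lambda>x. (fs n x - gs n x) - (f x - g x))
    \<le> 2 * sq_norm (\<lambda>x. fs n x - f x) + 2 * sq_norm (\<lambda>x. gs n x - g x)" for n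
    using sq_norm_diff_le[OF L2_diff[OF assms(1)[of n] assms(2)] L2_diff[OF assms(4)[of n] assms(5)]]
    by (simp add: algebra_simps)
  moreover have "(\<lambda>n. 2 * sq_norm (\<lambda>x. fs n x - f x) + 2 * sq_norm (\<lambda>x. gs n x - g x)) \<longlonglongrightarrow> 0"
    using tendsto_add[OF tendsto_mult_left[OF assms(3)[unfolded L2_tendsto_iff_sq_norm], of 2]
        tendsto_mult_left[OF assms(6)[unfolded L2_tendsto_iff_sq_norm], of 2]] by simp
  ultimately show ?thesis
    unfolding L2_tendsto_iff_sq_norm by (rule tendsto_0_squeeze[rotated 2]) simp
qed

lemma
  assumes g: "g \<in> L2" and S: "\<And>n. S n \<in> sets borel" and ev: "\<And>x. \<forall>\<^sub>F n in sequentially. x \<in> S n"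
  shows L2_cutoff: "(\<lambda>x. indicator (S n) x * g x) \<in> L2"
    and L2_tendsto_cutoff: "L2_tendsto (\<lambda>n x. indicator (S n) x * g x) g"
proof -
  note [measurable] = L2_measurable[OF g] S
  have "integrable lborel (\<lambda>x. (cmod (indicator (S n) x * g x))\<^sup>2)"
    by (rule Bochner_Integration.integrable_bound[OF L2_integrable[OF g]]) (auto split: split_indicator)
  then show "(\<lambda>x. indicator (S n) x * g x) \<in> L2"
    by (simp add: L2_def)
  have "(\<lambda>n. LINT x|lborel. (cmod (indicator (S n) x * g x - g x))\<^sup>2) \<longlonglongrightarrow> (LINT (x::real)|lborel. (0::real))"
  proof (rule integral_dominated_convergence[where w = "\<lambda>x. (cmod (g x))\<^sup>2"])
    show "AE x in lborel. (\<lambda>n. (cmod (indicator (S n) x * g x - g x))\<^sup>2) \<longlonglongrightarrow> 0"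
    proof (rule AE_I2)
      fix x
      have "\<forall>\<^sub>F n in sequentially. (cmod (indicator (S n) x * g x - g x))\<^sup>2 = 0"
        using ev[of x] by eventually_elim simp
      then show "(\<lambda>n. (cmod (indicator (S n) x * g x - g x))\<^sup>2) \<longlonglongrightarrow> 0"
        by (rule tendsto_eventually)
    qed
  qed (use L2_integrable[OF g] in \<open>auto split: split_indicator\<close>)
  then show "L2_tendsto (\<lambda>n x. indicator (S n) x * g x) g"
    by (simp add: L2_tendsto_def)
qed

lemma eventually_in_symmetric_interval: "\<forall>\<^sub>F n in sequentially. x \<in> {- real n..real n}"
  using eventually_ge_at_top[of "nat \<lceil>\<bar>x\<bar>\<rceil>"]
  by eventually_elim (auto simp: nat_le_iff ceiling_le_iff abs_le_iff)

lemma L1_cutoff_interval: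
  assumes g: "g \<in> L2"
  shows "(\<lambda>x. indicator {- r..r} x * g x) \<in> L1"
proof -
  note [measurable] = L2_measurable[OF g]
  have "integrable lborel (\<lambda>x. indicator {-r..r} x + (cmod (g x))\<^sup>2 :: real)"
    using L2_integrable[OF g] by (intro Bochner_Integration.integrable_add integrable_real_indicator)
       (auto simp: emeasure_lborel_Icc_eq)
  then show ?thesis
    unfolding L1_iff
  proof (rule Bochner_Integration.integrable_bound)
    have "cmod (g x) \<le> 1 + (cmod (g x))\<^sup>2" for x
    proof -
      have "2 * cmod (g x) \<le> (cmod (g x))\<^sup>2 + 1" using sum_squares_bound[of "cmod (g x)" 1] by simp
      then show ?thesis using norm_ge_zero[of "g x"] by linarith
    qed
    then show "AE x in lborel. norm (indicator {- r..r} x * g x) \<le> norm (indicator {-r..r} x + (cmod (g x))\<^sup>2 :: real)"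
      by (auto split: split_indicator)
  qed measurable
qed

text \<open>Cutting \<open>f\<close> off at large values gives bounded functions whose transforms converge pointwise. Fatou's
  lemma yields the inequality for every such \<open>f\<close>; the inequality for the difference between \<open>f\<close> and its
  cutoffs makes their transforms converge in \<open>L2\<close>, which upgrades it to equality.\<close>

lemma
  assumes f: "f \<in> L1" "f \<in> L2"
  shows fourier_integral_L2: "fourier_integral f \<in> L2"
    and plancherel: "sq_norm (fourier_integral f) = sq_norm f"
proof -
  have contract: "fourier_integral f \<in> L2 \<and> sq_norm (fourier_integral f) \<le> sq_norm f \<and>
      L2_tendsto (\<lambda>n x. indicator {x. cmod (f x) \<le> real n} x * f x) f \<and>
      (\<forall>n. (\<lambda>x. indicator {x. cmod (f x) \<le> real n} x * f x) \<in> L1 \<inter> L2) \<and>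
      (\<forall>n. fourier_integral (\<lambda>x. indicator {x. cmod (f x) \<le> real n} x * f x) \<in> L2) \<and>
      (\<forall>n. sq_norm (fourier_integral (\<lambda>x. indicator {x. cmod (f x) \<le> real n} x * f x))
          = sq_norm (\<lambda>x. indicator {x. cmod (f x) \<le> real n} x * f x))"
    if f: "f \<in> L1" "f \<in> L2" for f
  proof -
    note [measurable] = L2_measurable[OF f(2)]
    have fint: "integrable lborel f" using f(1) by (simp add: L1_iff)
    define S where "S n = {x. cmod (f x) \<le> real n}" for n
    have S: "S n \<in> sets borel" for n unfolding S_def by measurable
    note [measurable] = S
    have ev: "\<forall>\<^sub>F n in sequentially. x \<in> S n" for x
      using eventually_ge_at_top[of "nat \<lceil>cmod (f x)\<rceil>"]
      by eventually_elim (auto simp: S_def nat_le_iff ceiling_le_iff)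
    define fs where "fs n x = indicator (S n) x * f x" for n x
    have fs_L2: "fs n \<in> L2" and fs_lim: "L2_tendsto fs f" for n
      using L2_cutoff[OF f(2) S ev] L2_tendsto_cutoff[OF f(2) S ev] by (auto simp: fs_def[abs_def])
    have fs_int: "integrable lborel (fs n)" for n
      unfolding fs_def
      by (rule Bochner_Integration.integrable_bound[OF fint]) (auto split: split_indicator)
    have fs_bdd: "cmod (fs n x) \<le> real n" for n x
      by (auto simp: fs_def S_def split: split_indicator)
    note fs_meas [measurable] = L2_measurable[OF fs_L2]
    have Ffs: "fourier_integral (fs n) \<in> L2" "sq_norm (fourier_integral (fs n)) = sq_norm (fs n)" for n
      using integrable_norm_sq_fourier_integral_bounded[OF fs_int fs_bdd, of n]
        plancherel_bounded[OF fs_int fs_bdd, of n] by (simp_all add: L2_def sq_norm_def)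
    have ptw: "(\<lambda>n. fourier_integral (fs n) t) \<longlonglongrightarrow> fourier_integral f t" for t
    proof -
      have "(\<lambda>n. LINT x|lborel. cis (- (t * x)) * fs n x) \<longlonglongrightarrow> (LINT x|lborel. cis (- (t * x)) * f x)"
      proof (rule integral_dominated_convergence[where w = "\<lambda>x. cmod (f x)"])
        show "AE x in lborel. (\<lambda>n. cis (- (t * x)) * fs n x) \<longlonglongrightarrow> cis (- (t * x)) * f x"
        proof (rule AE_I2)
          fix x
          have "\<forall>\<^sub>F n in sequentially. cis (- (t * x)) * fs n x = cis (- (t * x)) * f x"
            using ev[of x] by eventually_elim (simp add: fs_def)
          then show "(\<lambda>n. cis (- (t * x)) * fs n x) \<longlonglongrightarrow> cis (- (t * x)) * f x"
            by (rule tendsto_eventually)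
        qed
      qed (use fint in \<open>auto simp: fs_def norm_mult split: split_indicator\<close>)
      then show ?thesis unfolding fourier_integral_cis by (intro tendsto_intros)
    qed
    have "(\<integral>\<^sup>+t. ennreal ((cmod (fourier_integral f t))\<^sup>2) \<partial>lborel)
        = (\<integral>\<^sup>+t. liminf (\<lambda>n. ennreal ((cmod (fourier_integral (fs n) t))\<^sup>2)) \<partial>lborel)"
    proof (intro nn_integral_cong)
      fix t
      have "(\<lambda>n. ennreal ((cmod (fourier_integral (fs n) t))\<^sup>2)) \<longlonglongrightarrow> ennreal ((cmod (fourier_integral f t))\<^sup>2)"
        by (intro tendsto_ennrealI tendsto_intros ptw)
      then show "ennreal ((cmod (fourier_integral f t))\<^sup>2) = liminf (\<lambda>n. ennreal ((cmod (fourier_integral (fs n) t))\<^sup>2))"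
        by (rule lim_imp_Liminf[OF sequentially_bot, symmetric])
    qed
    also have "\<dots> \<le> liminf (\<lambda>n. \<integral>\<^sup>+t. ennreal ((cmod (fourier_integral (fs n) t))\<^sup>2) \<partial>lborel)"
      by (rule nn_integral_liminf) measurable
    also have "\<dots> \<le> ennreal (sq_norm f)"
    proof (rule Liminf_le, simp, intro always_eventually allI)
      fix n
      have "(\<integral>\<^sup>+t. ennreal ((cmod (fourier_integral (fs n) t))\<^sup>2) \<partial>lborel) = ennreal (sq_norm (fs n))"
        using L2_integrable[OF Ffs(1)[of n]] by (simp add: nn_integral_eq_integral Ffs(2)[symmetric]) (simp add: sq_norm_def)
      also have "sq_norm (fs n) \<le> sq_norm f"
        unfolding sq_norm_def
        by (intro integral_mono L2_integrable f fs_L2) (auto simp: fs_def split: split_indicator)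
      finally show "(\<integral>\<^sup>+t. ennreal ((cmod (fourier_integral (fs n) t))\<^sup>2) \<partial>lborel) \<le> ennreal (sq_norm f)"
        by (simp add: ennreal_leI)
    qed
    finally have le: "(\<integral>\<^sup>+t. ennreal ((cmod (fourier_integral f t))\<^sup>2) \<partial>lborel) \<le> ennreal (sq_norm f)" .
    then have "integrable lborel (\<lambda>t. (cmod (fourier_integral f t))\<^sup>2)"
      by (intro integrableI_nonneg) (auto intro: le_less_trans)
    then have "fourier_integral f \<in> L2" "sq_norm (fourier_integral f) \<le> sq_norm f"
      using le by (auto simp: L2_def sq_norm_def nn_integral_eq_integral)
    then show ?thesis
      using fs_L2 fs_lim fs_int Ffs by (auto simp: L1_iff fs_def[abs_def] S_def)
  qed
  define fs where "fs n = (\<lambda>x. indicator {x. cmod (f x) \<le> real n} x * f x)" for n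
  have Ff: "fourier_integral f \<in> L2" and fs_lim: "L2_tendsto fs f" and fs: "fs n \<in> L1" "fs n \<in> L2"
    and Ffs: "fourier_integral (fs n) \<in> L2" "sq_norm (fourier_integral (fs n)) = sq_norm (fs n)" for n
    using contract[OF f] by (auto simp: fs_def[abs_def])
  show "fourier_integral f \<in> L2" by fact
  have "sq_norm (\<lambda>x. fourier_integral (fs n) x - fourier_integral f x) \<le> sq_norm (\<lambda>x. fs n x - f x)" for n
  proof -
    have "(\<lambda>x. fs n x - f x) \<in> L1" "(\<lambda>x. fs n x - f x) \<in> L2"
      using fs f by (auto simp: L1_iff L2_diff)
    from contract[OF this] have "sq_norm (fourier_integral (\<lambda>x. fs n x - f x)) \<le> sq_norm (\<lambda>x. fs n x - f x)"
      by blast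
    moreover have "fourier_integral (\<lambda>x. fs n x - f x) = (\<lambda>x. fourier_integral (fs n) x - fourier_integral f x)"
      using fs(1) f(1) by (intro ext fourier_integral_diff) (auto simp: L1_iff)
    ultimately show ?thesis by simp
  qed
  then have "L2_tendsto (\<lambda>n. fourier_integral (fs n)) (fourier_integral f)"
    unfolding L2_tendsto_iff_sq_norm
    by (rule tendsto_0_squeeze[OF fs_lim[unfolded L2_tendsto_iff_sq_norm] sq_norm_nonneg])
  from sq_norm_tendsto[OF Ffs(1) Ff this]
  have "(\<lambda>n. sq_norm (fs n)) \<longlonglongrightarrow> sq_norm (fourier_integral f)" by (simp add: Ffs(2))
  with sq_norm_tendsto[OF fs(2) f(2) fs_lim] show "sq_norm (fourier_integral f) = sq_norm f"
    using LIMSEQ_unique by blast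
qed

section \<open>The Fourier transform of square integrable functions\<close>

lemma cmod_diff_sq: "(cmod (u - v))\<^sup>2 = (cmod u)\<^sup>2 + (cmod v)\<^sup>2 - 2 * Re (u * cnj v)"
  by (simp add: cmod_power2) (simp add: power2_eq_square algebra_simps)

lemma is_fourier_L2_diff:
  assumes "is_fourier_L2 f F" "is_fourier_L2 g G"
  shows "is_fourier_L2 (\<lambda>x. f x - g x) (\<lambda>t. F t - G t)"
proof -
  obtain fs gs where f: "f \<in> L2" "F \<in> L2" and fs: "\<And>n. fs n \<in> L1 \<inter> L2"
      "L2_tendsto fs f" "L2_tendsto (\<lambda>n. fourier_integral (fs n)) F"
    and g: "g \<in> L2" "G \<in> L2" and gs: "\<And>n. gs n \<in> L1 \<inter> L2"
      "L2_tendsto gs g" "L2_tendsto (\<lambda>n. fourier_integral (gs n)) G"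
    using assms unfolding is_fourier_L2_def by auto
  have fs': "fs n \<in> L1" "fs n \<in> L2" "gs n \<in> L1" "gs n \<in> L2" for n using fs gs by auto
  have eq: "fourier_integral (\<lambda>x. fs n x - gs n x) = (\<lambda>t. fourier_integral (fs n) t - fourier_integral (gs n) t)" for n
    using fs' by (intro ext fourier_integral_diff) (auto simp: L1_iff)
  show ?thesis
    unfolding is_fourier_L2_def
  proof (intro conjI exI allI)
    show "(\<lambda>x. fs n x - gs n x) \<in> L1 \<inter> L2" for n
      using fs'[of n] by (auto simp: L1_iff L2_diff)
    show "L2_tendsto (\<lambda>n x. fs n x - gs n x) (\<lambda>x. f x - g x)"
      using fs' f g fs gs by (intro L2_tendsto_diff)
    show "L2_tendsto (\<lambda>n. fourier_integral (\<lambda>x. fs n x - gs n x)) (\<lambda>t. F t - G t)"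
      unfolding eq using fs' f g fs gs by (intro L2_tendsto_diff fourier_integral_L2)
  qed (use f g in \<open>auto intro: L2_diff\<close>)
qed

text \<open>Plancherel passes to limits of approximating sequences, so linearity and this isometry show that a
  transform of the zero function vanishes almost everywhere.\<close>

lemma is_fourier_L2_isometry:
  assumes "is_fourier_L2 g G"
  shows "sq_norm G = sq_norm g"
proof -
  obtain gs where g: "g \<in> L2" "G \<in> L2" and gs: "\<And>n. gs n \<in> L1 \<inter> L2"
      "L2_tendsto gs g" "L2_tendsto (\<lambda>n. fourier_integral (gs n)) G"
    using assms unfolding is_fourier_L2_def by auto
  have gs': "gs n \<in> L1" "gs n \<in> L2" for n using gs by auto
  have "(\<lambda>n. sq_norm (gs n)) \<longlonglongrightarrow> sq_norm g"
    using gs' g gs by (intro sq_norm_tendsto)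
  moreover have "(\<lambda>n. sq_norm (fourier_integral (gs n))) \<longlonglongrightarrow> sq_norm G"
    using gs' g gs by (intro sq_norm_tendsto fourier_integral_L2)
  ultimately show ?thesis
    using LIMSEQ_unique by (auto simp: plancherel[OF gs'])
qed

lemma is_fourier_L2_unique:
  assumes "is_fourier_L2 g G" "is_fourier_L2 g H"
  shows "AE t in lborel. G t = H t"
proof -
  have d: "is_fourier_L2 (\<lambda>x. g x - g x) (\<lambda>t. G t - H t)"
    by (rule is_fourier_L2_diff[OF assms])
  then have "sq_norm (\<lambda>t. G t - H t) = 0"
    using is_fourier_L2_isometry[OF d] by (simp add: sq_norm_def)
  moreover have "integrable lborel (\<lambda>t. (cmod (G t - H t))\<^sup>2)"
    using d by (intro L2_integrable) (simp add: is_fourier_L2_def)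
  ultimately have "AE t in lborel. (cmod (G t - H t))\<^sup>2 = 0"
    unfolding sq_norm_def by (subst (asm) integral_nonneg_eq_0_iff_AE) auto
  then show ?thesis by simp
qed

text \<open>The case of the Riesz-Fischer theorem for rapidly Cauchy sequences: the increments are almost
  everywhere summable, and Fatou's lemma carries the Cauchy estimate over to the pointwise limit.\<close>

lemma L2_complete_fast_Cauchy:
  assumes G: "\<And>k. G k \<in> L2" and fast: "\<And>k m. k \<le> m \<Longrightarrow> sq_norm (\<lambda>x. G m x - G k x) \<le> (1 / 4) ^ k"
  obtains H where "H \<in> L2" "L2_tendsto G H"
proof -
  note [measurable] = L2_measurable[OF G]
  define D where "D k x = G (Suc k) x - G k x" for k x
  have D: "D k \<in> L2" for k unfolding D_def by (intro L2_diff G)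
  note [measurable] = L2_measurable[OF D]
  have nn: "(\<integral>\<^sup>+x. ennreal ((cmod (f x))\<^sup>2) \<partial>lborel) = ennreal (sq_norm f)" if "f \<in> L2" for f
    unfolding sq_norm_def by (rule nn_integral_eq_integral[OF L2_integrable[OF that]]) simp
  have "(\<integral>\<^sup>+x. (\<Sum>k. ennreal (2 ^ k * (cmod (D k x))\<^sup>2)) \<partial>lborel)
      = (\<Sum>k. \<integral>\<^sup>+x. ennreal (2 ^ k * (cmod (D k x))\<^sup>2) \<partial>lborel)"
    by (rule nn_integral_suminf) measurable
  also have "\<dots> \<le> (\<Sum>k. ennreal ((1 / 2) ^ k))"
  proof (rule suminf_le)
    fix k
    have "(\<integral>\<^sup>+x. ennreal (2 ^ k * (cmod (D k x))\<^sup>2) \<partial>lborel) = ennreal (2 ^ k) * ennreal (sq_norm (D k))"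
      by (simp add: ennreal_mult nn_integral_cmult nn[OF D])
    also have "\<dots> = ennreal (2 ^ k * sq_norm (D k))" by (simp add: ennreal_mult)
    also have "\<dots> \<le> ennreal (2 ^ k * (1 / 4) ^ k)"
      using fast[of k "Suc k"] by (intro ennreal_leI mult_left_mono) (auto simp: D_def[abs_def])
    also have "2 ^ k * (1 / 4) ^ k = ((1 / 2) ^ k :: real)"
      by (simp flip: power_mult_distrib)
    finally show "(\<integral>\<^sup>+x. ennreal (2 ^ k * (cmod (D k x))\<^sup>2) \<partial>lborel) \<le> ennreal ((1 / 2) ^ k)" .
  qed auto
  also have "\<dots> = ennreal (\<Sum>k. (1 / 2) ^ k)"
    by (rule suminf_ennreal2) auto
  finally have "(\<integral>\<^sup>+x. (\<Sum>k. ennreal (2 ^ k * (cmod (D k x))\<^sup>2)) \<partial>lborel) \<noteq> \<infinity>"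
    by (auto simp: top_unique)
  then have "AE x in lborel. (\<Sum>k. ennreal (2 ^ k * (cmod (D k x))\<^sup>2)) \<noteq> \<infinity>"
    by (intro nn_integral_noteq_infinite) measurable
  then have conv: "AE x in lborel. convergent (\<lambda>k. G k x)"
  proof eventually_elim
    case (elim x)
    then have s: "summable (\<lambda>k. 2 ^ k * (cmod (D k x))\<^sup>2)"
      by (intro summable_suminf_not_top) auto
    have "summable (\<lambda>k. (1 / 2) ^ k + 2 ^ k * (cmod (D k x))\<^sup>2 :: real)"
      by (intro summable_add s) simp
    moreover have "norm (D k x) \<le> (1 / 2) ^ k + 2 ^ k * (cmod (D k x))\<^sup>2" for k
    proof -
      \<comment> \<open>The arithmetic-geometric mean inequality for \<open>(1 / 2) ^ k\<close> and \<open>2 ^ k * (cmod (D k x))\<^sup>2\<close>.\<close>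
      have "2 * (2 ^ k * cmod (D k x)) \<le> (2 ^ k * cmod (D k x))\<^sup>2 + 1"
        using sum_squares_bound[of "2 ^ k * cmod (D k x)" 1] by simp
      moreover have "0 \<le> 2 ^ k * cmod (D k x)" by simp
      ultimately have "2 ^ k * cmod (D k x) \<le> (2 ^ k * cmod (D k x))\<^sup>2 + 1" by linarith
      then have "(1 / 2) ^ k * (2 ^ k * cmod (D k x)) \<le> (1 / 2) ^ k * ((2 ^ k * cmod (D k x))\<^sup>2 + 1)"
        by (intro mult_left_mono) auto
      then show ?thesis
        by (simp add: power_mult_distrib power2_eq_square power_one_over field_simps)
    qed
    ultimately have "summable (\<lambda>k. D k x)"
      by (rule summable_comparison_test'[where N = 0])
    then have "convergent (\<lambda>n. G 0 x + (\<Sum>k<n. D k x))"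
      by (intro convergent_add convergent_const) (simp add: summable_iff_convergent)
    moreover have "G 0 x + (\<Sum>k<n. D k x) = G n x" for n
      unfolding D_def by (subst sum_lessThan_telescope) simp
    ultimately show ?case by simp
  qed
  define H where "H x = lim (\<lambda>k. G k x)" for x
  have [measurable]: "H \<in> borel_measurable borel"
    unfolding H_def[abs_def] by measurable
  have lim: "AE x in lborel. (\<lambda>k. G k x) \<longlonglongrightarrow> H x"
    using conv by eventually_elim (simp add: H_def convergent_LIMSEQ_iff)
  have bound: "(\<integral>\<^sup>+x. ennreal ((cmod (H x - G k x))\<^sup>2) \<partial>lborel) \<le> ennreal ((1 / 4) ^ k)" for k
  proof -
    have "(\<integral>\<^sup>+x. ennreal ((cmod (H x - G k x))\<^sup>2) \<partial>lborel)
        = (\<integral>\<^sup>+x. liminf (\<lambda>m. ennreal ((cmod (G m x - G k x))\<^sup>2)) \<partial>lborel)"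
    proof (rule nn_integral_cong_AE)
      show "AE x in lborel. ennreal ((cmod (H x - G k x))\<^sup>2) = liminf (\<lambda>m. ennreal ((cmod (G m x - G k x))\<^sup>2))"
        using lim
      proof eventually_elim
        case (elim x)
        then have "(\<lambda>m. ennreal ((cmod (G m x - G k x))\<^sup>2)) \<longlonglongrightarrow> ennreal ((cmod (H x - G k x))\<^sup>2)"
          by (intro tendsto_ennrealI tendsto_intros)
        then show ?case
          by (rule lim_imp_Liminf[OF sequentially_bot, symmetric])
      qed
    qed
    also have "\<dots> \<le> liminf (\<lambda>m. \<integral>\<^sup>+x. ennreal ((cmod (G m x - G k x))\<^sup>2) \<partial>lborel)"
      by (rule nn_integral_liminf) measurable
    also have "\<dots> \<le> ennreal ((1 / 4) ^ k)"
    proof (rule Liminf_le)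
      show "\<forall>\<^sub>F m in sequentially. (\<integral>\<^sup>+x. ennreal ((cmod (G m x - G k x))\<^sup>2) \<partial>lborel) \<le> ennreal ((1 / 4) ^ k)"
        using eventually_ge_at_top[of k]
        by eventually_elim (subst nn, auto intro!: L2_diff G ennreal_leI fast)
    qed simp
    finally show ?thesis .
  qed
  have diff: "(\<lambda>x. H x - G k x) \<in> L2" for k
  proof -
    have "integrable lborel (\<lambda>x. (cmod (H x - G k x))\<^sup>2)"
      by (rule integrableI_nonneg) (auto intro: le_less_trans[OF bound])
    then show ?thesis by (simp add: L2_def)
  qed
  have "(\<lambda>x. (H x - G 0 x) - (0 - G 0 x)) \<in> L2"
    using G[of 0] by (intro L2_diff diff) (simp add: L2_def)
  then have "H \<in> L2" by simp
  moreover have "L2_tendsto G H"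
    unfolding L2_tendsto_iff_sq_norm
  proof (rule tendsto_0_squeeze)
    show "(\<lambda>k. (1 / 4) ^ k :: real) \<longlonglongrightarrow> 0" by (rule LIMSEQ_realpow_zero) auto
    show "sq_norm (\<lambda>x. G k x - H x) \<le> (1 / 4) ^ k" for k
      using bound[of k] by (simp add: nn[OF diff] sq_norm_diff_commute[of "G k"])
  qed simp
  ultimately show thesis by (rule that)
qed

text \<open>Cutoffs to symmetric intervals lie in \<open>L1\<close> and \<open>L2\<close> and converge to \<open>g\<close>. Chosen to converge fast, their
  transforms form a rapidly Cauchy sequence by Plancherel.\<close>

lemma is_fourier_L2_exists:
  assumes g: "g \<in> L2"
  obtains G where "is_fourier_L2 g G"
proof -
  let ?cut = "\<lambda>n x. indicator {- real n..real n} x * g x"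
  have cut: "?cut n \<in> L1" "?cut n \<in> L2" for n
    using L1_cutoff_interval[OF g] L2_cutoff[OF g _ eventually_in_symmetric_interval] by auto
  have "(\<lambda>n. sq_norm (\<lambda>x. ?cut n x - g x)) \<longlonglongrightarrow> 0"
    using L2_tendsto_cutoff[OF g _ eventually_in_symmetric_interval] unfolding L2_tendsto_iff_sq_norm by simp
  \<comment> \<open>The exponent \<open>Suc k\<close> pays for the factor 4 lost in the distance of two cutoffs.\<close>
  then have "\<exists>N. sq_norm (\<lambda>x. ?cut N x - g x) < (1 / 4) ^ Suc k" for k
    using order_tendstoD(2)[of _ 0 sequentially "(1 / 4) ^ Suc k"] by (fastforce simp: eventually_sequentially)
  then obtain N where N: "\<And>k. sq_norm (\<lambda>x. ?cut (N k) x - g x) < (1 / 4) ^ Suc k"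
    by metis
  define gs where "gs k = ?cut (N k)" for k
  have gs: "gs k \<in> L1" "gs k \<in> L2" for k using cut by (auto simp: gs_def)
  have gsd: "(\<lambda>x. gs m x - gs k x) \<in> L1" "(\<lambda>x. gs m x - gs k x) \<in> L2" for k m
    using gs by (auto simp: L1_iff intro: L2_diff)
  have eq: "(\<lambda>t. fourier_integral (gs m) t - fourier_integral (gs k) t) = fourier_integral (\<lambda>x. gs m x - gs k x)" for k m
    using gs(1) by (intro ext fourier_integral_diff[symmetric]) (auto simp: L1_iff)
  have "sq_norm (\<lambda>t. fourier_integral (gs m) t - fourier_integral (gs k) t) \<le> (1 / 4) ^ k" if "k \<le> m" for k m
  proof -
    have "sq_norm (\<lambda>t. fourier_integral (gs m) t - fourier_integral (gs k) t)
        = sq_norm (\<lambda>x. (gs m x - g x) - (gs k x - g x))"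
      unfolding eq plancherel[OF gsd] by simp
    also have "\<dots> \<le> 2 * sq_norm (\<lambda>x. gs m x - g x) + 2 * sq_norm (\<lambda>x. gs k x - g x)"
      by (intro sq_norm_diff_le L2_diff gs g)
    also have "\<dots> \<le> 2 * (1 / 4) ^ Suc m + 2 * (1 / 4) ^ Suc k"
      using N[of m] N[of k] by (simp add: gs_def)
    also have "(1 / 4 :: real) ^ Suc m \<le> (1 / 4) ^ Suc k"
      using that by (intro power_decreasing) auto
    finally show ?thesis by simp
  qed
  then obtain G where G: "G \<in> L2" "L2_tendsto (\<lambda>k. fourier_integral (gs k)) G"
    using L2_complete_fast_Cauchy[of "\<lambda>k. fourier_integral (gs k)"] fourier_integral_L2[OF gs] by metis
  have "L2_tendsto gs g"
    unfolding L2_tendsto_iff_sq_norm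
  proof (rule tendsto_0_squeeze)
    show "(\<lambda>k. (1 / 4) ^ Suc k :: real) \<longlonglongrightarrow> 0"
      by (intro LIMSEQ_Suc LIMSEQ_realpow_zero) auto
    show "sq_norm (\<lambda>x. gs k x - g x) \<le> (1 / 4) ^ Suc k" for k
      using N[of k] by (simp add: gs_def)
  qed simp
  with G g gs have "is_fourier_L2 g G"
    unfolding is_fourier_L2_def by blast
  then show thesis by (rule that)
qed

text \<open>Let \<open>g\<close> be the inverse transform of \<open>R\<close> and \<open>gs n\<close> its cutoffs. By the multiplication formula the inner
  product of the transform of \<open>gs n\<close> with \<open>R\<close> equals that of \<open>gs n\<close> with \<open>g\<close>, which is the squared norm of
  \<open>gs n\<close>. Expanding the square, the squared distance from the transform of \<open>gs n\<close> to \<open>R\<close> is the squared norm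
  of \<open>g\<close> minus that of \<open>gs n\<close>, and this tends to \<open>0\<close>.\<close>

lemma is_fourier_L2_inverse:
  assumes R: "R \<in> L1" "R \<in> L2"
  shows "is_fourier_L2 (\<lambda>x. fourier_integral R (- x)) R"
proof -
  define g where "g x = fourier_integral R (- x)" for x
  note [measurable] = L2_measurable[OF R(2)]
  have FR: "fourier_integral R \<in> L2" by (rule fourier_integral_L2[OF R])
  note [measurable] = L2_measurable[OF FR]
  have "g \<in> borel_measurable borel" unfolding g_def[abs_def] by measurable
  then have g: "g \<in> L2"
    using FR lborel_integrable_real_affine[OF L2_integrable[OF FR], of "-1" 0]
    by (auto simp: L2_def g_def[abs_def])
  have norm_g: "sq_norm g = sq_norm R"
    using lborel_integral_real_affine[of "-1" "\<lambda>x. (cmod (fourier_integral R x))\<^sup>2" 0] plancherel[OF R]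
    by (simp add: sq_norm_def g_def[abs_def])
  define gs where "gs n x = indicator {- real n..real n} x * g x" for n x
  have gs: "gs n \<in> L1" "gs n \<in> L2" "L2_tendsto gs g" for n
    using L1_cutoff_interval[OF g] L2_cutoff[OF g _ eventually_in_symmetric_interval]
      L2_tendsto_cutoff[OF g _ eventually_in_symmetric_interval] by (auto simp: gs_def[abs_def])
  have cnjR: "integrable lborel (\<lambda>t. cnj (R t))" "(\<lambda>t. cnj (R t)) \<in> L2"
    using R by (auto simp: L1_iff L2_def)
  have FcnjR: "fourier_integral (\<lambda>t. cnj (R t)) x = cnj (g x)" for x
    using fourier_integral_reflected_cnj[of "\<lambda>x. R (- x)" x]
      lborel_integral_real_affine[of "-1" "\<lambda>t. cis (- (x * t)) * R (- t)" 0]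
    by (simp add: g_def fourier_integral_cis)
  have "sq_norm (\<lambda>t. fourier_integral (gs n) t - R t) = sq_norm g - sq_norm (gs n)" for n
  proof -
    let ?F = "fourier_integral (gs n)"
    have F: "?F \<in> L2" by (rule fourier_integral_L2[OF gs(1,2)])
    have inner: "(LINT t|lborel. ?F t * cnj (R t)) = complex_of_real (sq_norm (gs n))"
    proof -
      have "(LINT t|lborel. ?F t * cnj (R t)) = (LINT x|lborel. gs n x * cnj (g x))"
        using fourier_integral_multiplication[of "gs n" "\<lambda>t. cnj (R t)"] gs(1) cnjR FcnjR
        by (simp add: L1_iff)
      also have "\<dots> = (LINT x|lborel. complex_of_real ((cmod (gs n x))\<^sup>2))"
        by (intro Bochner_Integration.integral_cong)
           (auto simp: gs_def complex_norm_square simp del: of_real_power split: split_indicator)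
      finally show ?thesis by (simp add: sq_norm_def del: of_real_power)
    qed
    define q where "q t = Re (?F t * cnj (R t))" for t
    have i: "integrable lborel q"
      unfolding q_def by (intro integrable_Re L2_mult_integrable F cnjR)
    have "sq_norm (\<lambda>t. ?F t - R t)
        = (LINT t|lborel. (cmod (?F t))\<^sup>2 + (cmod (R t))\<^sup>2 - 2 * q t)"
      by (simp only: sq_norm_def q_def cmod_diff_sq)
    also have "\<dots> = sq_norm ?F + sq_norm R - 2 * (LINT t|lborel. q t)"
      using i L2_integrable[OF F] L2_integrable[OF R(2)] by (simp add: sq_norm_def)
    also have "(LINT t|lborel. q t) = sq_norm (gs n)"
      unfolding q_def integral_Re[OF L2_mult_integrable[OF F cnjR(2)]] inner by simp
    finally show ?thesis
      by (simp add: plancherel[OF gs(1,2)] norm_g)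
  qed
  moreover have "(\<lambda>n. sq_norm g - sq_norm (gs n)) \<longlonglongrightarrow> sq_norm g - sq_norm g"
    by (intro tendsto_diff tendsto_const sq_norm_tendsto gs g)
  ultimately have "L2_tendsto (\<lambda>n. fourier_integral (gs n)) R"
    by (simp add: L2_tendsto_iff_sq_norm)
  with g R gs show ?thesis
    unfolding is_fourier_L2_def g_def[symmetric] by blast
qed

lemma is_fourier_L2_fourier:
  assumes g: "g \<in> L2"
  shows "is_fourier_L2 g (fourier g)"
proof (cases "g \<in> L1")
  case True
  have "L2_tendsto (\<lambda>n. f) f" for f by (simp add: L2_tendsto_def)
  with True g show ?thesis
    by (auto simp: is_fourier_L2_def fourier_def intro!: fourier_integral_L2 exI[of _ "\<lambda>n. g"])
next
  case False
  obtain G where "is_fourier_L2 g G" using is_fourier_L2_exists[OF g] .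
  then show ?thesis using False by (simp add: fourier_def someI)
qed

lemma fourier_diff_AE:
  assumes f: "f \<in> L2" and g: "g \<in> L2"
  shows "AE t in lborel. fourier (\<lambda>x. f x - g x) t = fourier f t - fourier g t"
  by (intro is_fourier_L2_unique[of "\<lambda>x. f x - g x"] is_fourier_L2_diff is_fourier_L2_fourier L2_diff f g)

lemma fourier_surj:
  assumes "R \<in> L1" "R \<in> L2"
  obtains g where "g \<in> L2" "AE t in lborel. fourier g t = R t"
proof -
  have R: "is_fourier_L2 (\<lambda>x. fourier_integral R (- x)) R" by (rule is_fourier_L2_inverse[OF assms])
  then have "(\<lambda>x. fourier_integral R (- x)) \<in> L2" by (simp add: is_fourier_L2_def)
  with R that show thesis
    by (blast intro: is_fourier_L2_unique is_fourier_L2_fourier)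
qed

section \<open>Transforms of the kernel estimator and of the sample\<close>

text \<open>The argument \<open>- (h * t)\<close> has its sign because the estimator uses \<open>K ((y j - z) / h)\<close> as a function
  of \<open>z\<close>, that is, the reflected kernel.\<close>

lemma fourier_kernel_estimator:
  assumes K: "K \<in> L1" and h: "h > 0"
  shows "fourier (kernel_estimator K h n y) t
        = (\<Sum>j=1..n. cis (- (t * y j))) / of_nat n * fourier K (- (h * t))"
proof -
  have Kint: "integrable lborel K" using K by (simp add: L1_iff)
  then have [measurable]: "K \<in> borel_measurable borel" by (auto dest: borel_measurable_integrable)
  have int: "integrable lborel (\<lambda>z. K ((x - z) / h))" for x
    using lborel_integrable_real_affine[OF Kint, of "- 1 / h" "x / h"] h
    by (simp add: diff_divide_distrib)
  have kint: "integrable lborel (kernel_estimator K h n y)"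
    unfolding kernel_estimator_def[abs_def]
    by (intro integrable_mult_right Bochner_Integration.integrable_sum int)
  then have k: "kernel_estimator K h n y \<in> L1" by (simp add: L1_iff)
  have single: "(LINT z|lborel. cis (- (t * z)) * K ((x - z) / h))
      = h * cis (- (t * x)) * (LINT u|lborel. cis (- (- (h * t) * u)) * K u)" for x
  proof -
    have "(LINT z|lborel. cis (- (t * z)) * K ((x - z) / h))
        = h *\<^sub>R (LINT u|lborel. cis (- (t * (x + - h * u))) * K ((x - (x + - h * u)) / h))"
      by (subst lborel_integral_real_affine[of "- h" _ x]) (use h in auto)
    also have "(LINT u|lborel. cis (- (t * (x + - h * u))) * K ((x - (x + - h * u)) / h))
        = (LINT u|lborel. cis (- (t * x)) * (cis (- (- (h * t) * u)) * K u))"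
      using h by (intro Bochner_Integration.integral_cong) (auto simp: cis_mult algebra_simps)
    finally show ?thesis by (simp add: scaleR_conv_of_real)
  qed
  have "(LINT z|lborel. cis (- (t * z)) * kernel_estimator K h n y z)
      = (LINT z|lborel. complex_of_real (1 / (real n * h)) * (\<Sum>j=1..n. cis (- (t * z)) * K ((y j - z) / h)))"
    by (simp add: kernel_estimator_def sum_distrib_left mult_ac)
  also have "\<dots> = complex_of_real (1 / (real n * h)) * (\<Sum>j=1..n. LINT z|lborel. cis (- (t * z)) * K ((y j - z) / h))"
    by (subst Bochner_Integration.integral_mult_right_zero, subst Bochner_Integration.integral_sum)
       (auto intro!: integrable_cis_mult int)
  also have "\<dots> = (\<Sum>j=1..n. cis (- (t * y j))) / of_nat n * (LINT u|lborel. cis (- (- (h * t) * u)) * K u)"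
    unfolding single using h by (simp add: sum_distrib_left[symmetric] sum_distrib_right[symmetric] field_simps)
  finally show "fourier (kernel_estimator K h n y) t
        = (\<Sum>j=1..n. cis (- (t * y j))) / of_nat n * fourier K (- (h * t))"
    using k K by (simp add: fourier_def fourier_integral_cis)
qed

text \<open>The limit at \<open>0\<close> controls small \<open>t\<close>; away from \<open>0\<close> the left side is bounded since \<open>K\<close> is
  integrable, and there \<open>|t| powr r\<close> is bounded below.\<close>

lemma kernel_class_global_bound:
  assumes K: "K \<in> kernel_class r" and r: "r \<ge> 0"
  obtains C where "C \<ge> 0"
    "\<And>t. t \<noteq> 0 \<Longrightarrow> cmod (1 - complex_of_real (sqrt (2 * pi)) * fourier K t) \<le> C * \<bar>t\<bar> powr r"
proof -
  let ?f = "\<lambda>t. cmod (1 - complex_of_real (sqrt (2 * pi)) * fourier K t)"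
  obtain \<kappa> where "((\<lambda>t. ?f t / \<bar>t\<bar> powr r) \<longlongrightarrow> \<kappa>) (at 0)" and KL1: "K \<in> L1"
    using K by (auto simp: kernel_class_def)
  then have "\<forall>\<^sub>F t in at 0. ?f t / \<bar>t\<bar> powr r < \<bar>\<kappa>\<bar> + 1"
    by (intro order_tendstoD(2)) auto
  then obtain \<delta> where \<delta>: "\<delta> > 0" "\<And>t. t \<noteq> 0 \<Longrightarrow> \<bar>t\<bar> < \<delta> \<Longrightarrow> ?f t / \<bar>t\<bar> powr r < \<bar>\<kappa>\<bar> + 1"
    by (auto simp: eventually_at dist_real_def)
  define B where "B = 1 + (LINT x|lborel. cmod (K x))"
  have B0: "B \<ge> 0" by (simp add: B_def add_nonneg_nonneg)
  have B: "?f t \<le> B" for t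
  proof -
    have "?f t \<le> 1 + cmod (complex_of_real (sqrt (2 * pi)) * fourier K t)"
      using norm_triangle_ineq4[of 1 "complex_of_real (sqrt (2 * pi)) * fourier K t"] by simp
    also have "cmod (complex_of_real (sqrt (2 * pi)) * fourier K t) = sqrt (2 * pi) * cmod (fourier_integral K t)"
      using KL1 by (simp add: norm_mult fourier_def)
    also have "\<dots> \<le> sqrt (2 * pi) * ((LINT x|lborel. cmod (K x)) / sqrt (2 * pi))"
      by (intro mult_left_mono norm_fourier_integral_le) simp
    finally show ?thesis by (simp add: B_def)
  qed
  show thesis
  proof (rule that)
    show "0 \<le> \<bar>\<kappa>\<bar> + 1 + B / \<delta> powr r" using B0 by (simp add: add_nonneg_nonneg)
    fix t :: real assume t: "t \<noteq> 0"
    show "?f t \<le> (\<bar>\<kappa>\<bar> + 1 + B / \<delta> powr r) * \<bar>t\<bar> powr r"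
    proof (cases "\<bar>t\<bar> < \<delta>")
      case True
      then have "?f t \<le> (\<bar>\<kappa>\<bar> + 1) * \<bar>t\<bar> powr r"
        using \<delta>(2)[OF t True] t by (simp add: divide_less_eq)
      also have "\<dots> \<le> (\<bar>\<kappa>\<bar> + 1 + B / \<delta> powr r) * \<bar>t\<bar> powr r"
        using B0 by (intro mult_right_mono) auto
      finally show ?thesis .
    next
      case False
      have "?f t \<le> B * 1" using B by simp
      also have "\<dots> \<le> B * (\<bar>t\<bar> powr r / \<delta> powr r)"
        using False \<delta>(1) r B0 by (intro mult_left_mono) (auto intro: powr_mono2)
      also have "\<dots> = B / \<delta> powr r * \<bar>t\<bar> powr r" by simp
      also have "\<dots> \<le> (\<bar>\<kappa>\<bar> + 1 + B / \<delta> powr r) * \<bar>t\<bar> powr r"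
        by (intro mult_right_mono) auto
      finally show ?thesis .
    qed
  qed
qed

lemma densities_L2D:
  assumes "f \<in> densities_L2"
  shows "integrable lborel (\<lambda>x. complex_of_real (f x))" "\<And>x. 0 \<le> f x"
    "(\<lambda>x. complex_of_real (f x)) \<in> L1" "(\<lambda>x. complex_of_real (f x)) \<in> L2" "f \<in> borel_measurable borel"
proof -
  show f: "\<And>x. 0 \<le> f x" "(\<lambda>x. complex_of_real (f x)) \<in> L2" "f \<in> borel_measurable borel"
    using assms by (auto simp: densities_L2_def)
  have "integrable lborel f"
    using assms by (intro integrableI_nonneg) (auto simp: densities_L2_def)
  then show "integrable lborel (\<lambda>x. complex_of_real (f x))" by simp
  then show "(\<lambda>x. complex_of_real (f x)) \<in> L1" by (simp add: L1_iff)
qed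

lemma expectation_cis_convolution:
  assumes f: "f \<in> densities_L2" and g: "g \<in> densities_L2"
    and Y: "distributed M lborel Y (\<lambda>y. ennreal (density_convolution f g y))"
  shows "(LINT \<omega>|M. cis (- (t * Y \<omega>)))
    = complex_of_real (2 * pi) * (fourier (\<lambda>x. complex_of_real (f x)) t * fourier (\<lambda>x. complex_of_real (g x)) t)"
proof -
  let ?f = "\<lambda>x. complex_of_real (f x)" and ?g = "\<lambda>x. complex_of_real (g x)"
  have conv: "complex_of_real (density_convolution f g y) = L1_convolution ?f ?g y" for y
    by (simp add: density_convolution_def L1_convolution_def flip: integral_complex_of_real)
  have nonneg: "0 \<le> density_convolution f g y" for y
    unfolding density_convolution_def
    by (intro Bochner_Integration.integral_nonneg mult_nonneg_nonneg densities_L2D(2) f g)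
  have m: "density_convolution f g \<in> borel_measurable borel"
    using distributed_real_measurable[OF _ Y] nonneg by simp
  have Ym: "Y \<in> borel_measurable M"
    using distributed_measurable[OF Y] by simp
  have "(LINT \<omega>|M. cis (- (t * Y \<omega>))) = (LINT y|distr M lborel Y. cis (- (t * y)))"
    using Ym by (subst integral_distr) auto
  also have "\<dots> = (LINT y|density lborel (\<lambda>y. ennreal (density_convolution f g y)). cis (- (t * y)))"
    using distributed_distr_eq_density[OF Y] by simp
  also have "\<dots> = (LINT y|lborel. cis (- (t * y)) * L1_convolution ?f ?g y)"
    using m nonneg by (subst integral_density) (auto simp: scaleR_conv_of_real conv mult.commute)
  also have "\<dots> = complex_of_real (sqrt (2 * pi)) * fourier_integral (L1_convolution ?f ?g) t"
    by (simp add: fourier_integral_cis)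
  also have "\<dots> = complex_of_real (2 * pi) * (fourier ?f t * fourier ?g t)"
    using densities_L2D(3)[OF f] densities_L2D(3)[OF g]
    unfolding fourier_integral_convolution[OF densities_L2D(1)[OF f] densities_L2D(1)[OF g]]
    by (simp add: fourier_def flip: of_real_mult mult.assoc)
  finally show ?thesis .
qed

text \<open>The variance of a mean of independent variables, in complex form: after expanding the squared
  modulus into a double sum, independence removes the terms off the diagonal.\<close>

lemma (in prob_space) mean_square_deviation_of_sample_mean:
  fixes f :: "real \<Rightarrow> complex"
  assumes indep: "indep_vars (\<lambda>_. borel) Y {1..}"
    and f [measurable]: "f \<in> borel_measurable borel" and bdd: "\<And>y. cmod (f y) \<le> 1"
    and mean: "\<And>j. j \<ge> 1 \<Longrightarrow> expectation (\<lambda>\<omega>. f (Y j \<omega>)) = \<mu>"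
    and n: "n \<ge> 1"
  shows "expectation (\<lambda>\<omega>. (cmod ((\<Sum>j=1..n. f (Y j \<omega>)) / of_nat n - \<mu>))\<^sup>2) \<le> 1 / real n"
proof -
  define W where "W j \<omega> = f (Y j \<omega>) - \<mu>" for j and \<omega> :: 'a
  have Y: "random_variable borel (Y j)" if "j \<ge> 1" for j
    using indep that by (auto simp: indep_vars_def)
  have fint: "integrable M (\<lambda>\<omega>. f (Y j \<omega>))" if "j \<ge> 1" for j
    using Y[OF that] bdd by (intro integrable_const_bound[of _ 1]) auto
  have Wint: "integrable M (W j)" if "j \<ge> 1" for j
    unfolding W_def using fint[OF that] by simp
  have EW: "expectation (W j) = 0" if "j \<ge> 1" for j
    using fint[OF that] mean[OF that] by (simp add: W_def[abs_def] prob_space)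
  have off: "integrable M (\<lambda>\<omega>. W j \<omega> * cnj (W k \<omega>)) \<and> expectation (\<lambda>\<omega>. W j \<omega> * cnj (W k \<omega>)) = 0"
    if jk: "j \<ge> 1" "k \<ge> 1" "j \<noteq> k" for j k
  proof -
    \<comment> \<open>The product rule for independent families needs one family carrying the conjugate on index \<open>k\<close> only.\<close>
    define Z where "Z i \<omega> = (if i = j then W j \<omega> else cnj (W k \<omega>))" for i and \<omega> :: 'a
    have "indep_vars (\<lambda>_. borel) (\<lambda>i \<omega>. (\<lambda>i y. if i = j then f y - \<mu> else cnj (f y - \<mu>)) i (Y i \<omega>)) {j, k}"
      using jk by (intro indep_vars_compose2[OF indep_vars_subset[OF indep]]) auto
    then have "indep_vars (\<lambda>_. borel) Z {j, k}"
      by (rule indep_vars_cong[THEN iffD1, rotated -1]) (auto simp: Z_def W_def)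
    moreover have "integrable M (Z i)" if "i \<in> {j, k}" for i
      using that jk Wint by (auto simp: Z_def[abs_def])
    ultimately have "expectation (\<lambda>\<omega>. \<Prod>i\<in>{j, k}. Z i \<omega>) = (\<Prod>i\<in>{j, k}. expectation (Z i))"
      "integrable M (\<lambda>\<omega>. \<Prod>i\<in>{j, k}. Z i \<omega>)"
      using indep_vars_lebesgue_integral[of "{j, k}" Z] indep_vars_integrable[of "{j, k}" Z] by auto
    then show ?thesis
      using jk EW by (auto simp: Z_def[abs_def])
  qed
  have diag: "integrable M (\<lambda>\<omega>. W j \<omega> * cnj (W j \<omega>)) \<and> Re (expectation (\<lambda>\<omega>. W j \<omega> * cnj (W j \<omega>))) \<le> 1"
    if j: "j \<ge> 1" for j
  proof -
    have sq: "integrable M (\<lambda>\<omega>. (cmod (f (Y j \<omega>)))\<^sup>2)"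
      using Y[OF j] bdd by (intro integrable_const_bound[of _ 1]) (auto simp: power_le_one)
    have i: "integrable M (\<lambda>\<omega>. f (Y j \<omega>) * cnj \<mu>)" using fint[OF j] by simp
    define q where "q \<omega> = Re (f (Y j \<omega>) * cnj \<mu>)" for \<omega>
    have q: "integrable M q" "expectation q = Re (expectation (\<lambda>\<omega>. f (Y j \<omega>) * cnj \<mu>))"
      unfolding q_def by (rule integrable_Re[OF i] integral_Re[OF i])+
    have eq: "W j \<omega> * cnj (W j \<omega>)
        = complex_of_real ((cmod (f (Y j \<omega>)))\<^sup>2 - 2 * q \<omega> + (cmod \<mu>)\<^sup>2)" for \<omega>
      unfolding complex_norm_square[symmetric] of_real_eq_iff W_def cmod_diff_sq q_def by simp
    have int: "integrable M (\<lambda>\<omega>. (cmod (f (Y j \<omega>)))\<^sup>2 - 2 * q \<omega> + (cmod \<mu>)\<^sup>2)"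
      using sq q by simp
    have "expectation (\<lambda>\<omega>. (cmod (f (Y j \<omega>)))\<^sup>2 - 2 * q \<omega> + (cmod \<mu>)\<^sup>2)
        = expectation (\<lambda>\<omega>. (cmod (f (Y j \<omega>)))\<^sup>2) - 2 * Re (expectation (\<lambda>\<omega>. f (Y j \<omega>) * cnj \<mu>)) + (cmod \<mu>)\<^sup>2"
      unfolding q(2)[symmetric] using sq q(1) by (simp add: prob_space)
    also have "expectation (\<lambda>\<omega>. f (Y j \<omega>) * cnj \<mu>) = \<mu> * cnj \<mu>"
      using mean[OF j] by simp
    also have "Re (\<mu> * cnj \<mu>) = (cmod \<mu>)\<^sup>2"
      by (metis Re_complex_of_real complex_norm_square)
    finally have "expectation (\<lambda>\<omega>. (cmod (f (Y j \<omega>)))\<^sup>2 - 2 * q \<omega> + (cmod \<mu>)\<^sup>2)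
        \<le> expectation (\<lambda>\<omega>. (cmod (f (Y j \<omega>)))\<^sup>2)"
      by simp
    also have "\<dots> \<le> expectation (\<lambda>\<omega>. 1)"
      using sq bdd by (intro integral_mono) (auto simp: power_le_one)
    also have "\<dots> = 1" by (simp add: prob_space)
    finally have "expectation (\<lambda>\<omega>. (cmod (f (Y j \<omega>)))\<^sup>2 - 2 * q \<omega> + (cmod \<mu>)\<^sup>2) \<le> 1" .
    then show ?thesis
      unfolding eq using int by (simp only: integral_complex_of_real complex_of_real_integrable_eq Re_complex_of_real)
  qed
  have Wint2: "integrable M (\<lambda>\<omega>. W j \<omega> * cnj (W k \<omega>))" if "j \<ge> 1" "k \<ge> 1" for j k
    using off[OF that] diag[OF that(1)] by (cases "j = k") auto
  have expand: "complex_of_real ((cmod ((\<Sum>j=1..n. f (Y j \<omega>)) / of_nat n - \<mu>))\<^sup>2)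
      = (\<Sum>j=1..n. \<Sum>k=1..n. W j \<omega> * cnj (W k \<omega>)) / of_nat (n\<^sup>2)" for \<omega>
  proof -
    have eq: "(\<Sum>j=1..n. f (Y j \<omega>)) / of_nat n - \<mu> = (\<Sum>j=1..n. W j \<omega>) / of_nat n"
      using n by (simp add: W_def sum_subtractf field_simps)
    show ?thesis
      unfolding eq complex_norm_square by (simp add: sum_product power2_eq_square)
  qed
  have "complex_of_real (expectation (\<lambda>\<omega>. (cmod ((\<Sum>j=1..n. f (Y j \<omega>)) / of_nat n - \<mu>))\<^sup>2))
      = expectation (\<lambda>\<omega>. (\<Sum>j=1..n. \<Sum>k=1..n. W j \<omega> * cnj (W k \<omega>)) / of_nat (n\<^sup>2))"
    unfolding integral_complex_of_real[symmetric] expand ..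
  also have "\<dots> = expectation (\<lambda>\<omega>. \<Sum>j=1..n. \<Sum>k=1..n. W j \<omega> * cnj (W k \<omega>)) / of_nat (n\<^sup>2)"
    by (rule integral_divide_zero)
  also have "expectation (\<lambda>\<omega>. \<Sum>j=1..n. \<Sum>k=1..n. W j \<omega> * cnj (W k \<omega>))
      = (\<Sum>j=1..n. \<Sum>k=1..n. expectation (\<lambda>\<omega>. W j \<omega> * cnj (W k \<omega>)))"
  proof -
    have "expectation (\<lambda>\<omega>. \<Sum>k=1..n. W j \<omega> * cnj (W k \<omega>)) = (\<Sum>k=1..n. expectation (\<lambda>\<omega>. W j \<omega> * cnj (W k \<omega>)))"
      if "j \<in> {1..n}" for j
      by (rule Bochner_Integration.integral_sum, rule Wint2) (use that in auto)
    moreover have "expectation (\<lambda>\<omega>. \<Sum>j=1..n. \<Sum>k=1..n. W j \<omega> * cnj (W k \<omega>))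
        = (\<Sum>j=1..n. expectation (\<lambda>\<omega>. \<Sum>k=1..n. W j \<omega> * cnj (W k \<omega>)))"
      by (rule Bochner_Integration.integral_sum, rule Bochner_Integration.integrable_sum, rule Wint2) auto
    ultimately show ?thesis by simp
  qed
  also have "\<dots> = (\<Sum>j=1..n. expectation (\<lambda>\<omega>. W j \<omega> * cnj (W j \<omega>)))"
  proof (intro sum.cong refl)
    fix j assume j: "j \<in> {1..n}"
    have "(\<Sum>k=1..n. expectation (\<lambda>\<omega>. W j \<omega> * cnj (W k \<omega>)))
        = (\<Sum>k=1..n. if k = j then expectation (\<lambda>\<omega>. W j \<omega> * cnj (W j \<omega>)) else 0)"
      using off j by (intro sum.cong) auto
    then show "(\<Sum>k=1..n. expectation (\<lambda>\<omega>. W j \<omega> * cnj (W k \<omega>))) = expectation (\<lambda>\<omega>. W j \<omega> * cnj (W j \<omega>))"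
      using j by simp
  qed
  finally have E: "complex_of_real (expectation (\<lambda>\<omega>. (cmod ((\<Sum>j=1..n. f (Y j \<omega>)) / of_nat n - \<mu>))\<^sup>2))
      = (\<Sum>j=1..n. expectation (\<lambda>\<omega>. W j \<omega> * cnj (W j \<omega>))) / of_nat (n\<^sup>2)" .
  have "expectation (\<lambda>\<omega>. (cmod ((\<Sum>j=1..n. f (Y j \<omega>)) / of_nat n - \<mu>))\<^sup>2)
      = Re ((\<Sum>j=1..n. expectation (\<lambda>\<omega>. W j \<omega> * cnj (W j \<omega>))) / of_nat (n\<^sup>2))"
    unfolding E[symmetric] Re_complex_of_real ..
  also have "\<dots> = (\<Sum>j=1..n. Re (expectation (\<lambda>\<omega>. W j \<omega> * cnj (W j \<omega>)))) / real (n\<^sup>2)"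
    by (subst of_real_of_nat_eq[symmetric], subst Re_divide_of_real) (simp only: Re_sum)
  also have "\<dots> \<le> (\<Sum>j=1..n. 1) / real (n\<^sup>2)"
    using diag by (intro divide_right_mono sum_mono) auto
  also have "\<dots> = 1 / real n"
    using n by (simp add: power2_eq_square)
  finally show ?thesis .
qed

section \<open>Thresholded division by the error transform\<close>

text \<open>The factor that turns the transform of the estimator of the density of the observations into
  the transform of the deconvolution estimator.\<close>

definition inversion_factor :: "(real \<Rightarrow> complex) \<Rightarrow> real \<Rightarrow> real \<Rightarrow> real \<Rightarrow> complex" where
  "inversion_factor \<phi> s \<alpha> t =
    cnj (\<phi> t) / complex_of_real (sqrt (2 * pi) * (cmod (\<phi> t))\<^sup>2)
      * indicator {u. (cmod (\<phi> u / complex_of_real (ell s u)))\<^sup>2 \<ge> \<alpha>} t"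

lemma threshold_iff:
  "(cmod (\<phi> / complex_of_real (ell s t)))\<^sup>2 \<ge> \<alpha> \<longleftrightarrow> \<alpha> * (1 + t\<^sup>2) powr s \<le> (cmod \<phi>)\<^sup>2"
proof -
  have pos: "1 + t\<^sup>2 > 0" by (simp add: add_pos_nonneg)
  have "(ell s t)\<^sup>2 = (1 + t\<^sup>2) powr s"
    using pos by (simp add: ell_def power2_eq_square flip: powr_add)
  then have "(cmod (\<phi> / complex_of_real (ell s t)))\<^sup>2 = (cmod \<phi>)\<^sup>2 / (1 + t\<^sup>2) powr s"
    by (simp add: norm_divide power_divide)
  then show ?thesis
    using pos by (simp add: le_divide_eq)
qed

lemma inversion_factor_above:
  assumes "\<alpha> * (1 + t\<^sup>2) powr s \<le> (cmod (\<phi> t))\<^sup>2"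
  shows "inversion_factor \<phi> s \<alpha> t = cnj (\<phi> t) / complex_of_real (sqrt (2 * pi) * (cmod (\<phi> t))\<^sup>2)"
  using assms by (simp add: inversion_factor_def threshold_iff)

lemma inversion_factor_below:
  assumes "\<not> \<alpha> * (1 + t\<^sup>2) powr s \<le> (cmod (\<phi> t))\<^sup>2"
  shows "inversion_factor \<phi> s \<alpha> t = 0"
  using assms by (simp add: inversion_factor_def threshold_iff)

lemma measurable_inversion_factor [measurable (raw)]:
  assumes [measurable]: "\<phi> \<in> borel_measurable borel"
  shows "inversion_factor \<phi> s \<alpha> \<in> borel_measurable borel"
  unfolding inversion_factor_def[abs_def] ell_def by measurable

text \<open>Where the factor is nonzero its squared modulus is \<open>1 / (2\<pi> |\<phi>|\<^sup>2)\<close>, and the threshold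
  condition is exactly a lower bound of \<open>|\<phi>|\<^sup>2\<close> by a multiple of the weight.\<close>

lemma inversion_factor_weighted_bound:
  assumes \<alpha>: "\<alpha> > 0"
  shows "(1 + t\<^sup>2) powr s * (cmod (inversion_factor \<phi> s \<alpha> t))\<^sup>2 \<le> 1 / (2 * pi * \<alpha>)"
proof (cases "\<alpha> * (1 + t\<^sup>2) powr s \<le> (cmod (\<phi> t))\<^sup>2")
  case True
  have pos: "1 + t\<^sup>2 > 0" by (simp add: add_pos_nonneg)
  with \<alpha> have \<alpha>w: "0 < \<alpha> * (1 + t\<^sup>2) powr s" by simp
  then have \<phi>: "(cmod (\<phi> t))\<^sup>2 > 0" using True by (rule less_le_trans)
  have "(cmod (inversion_factor \<phi> s \<alpha> t))\<^sup>2 = (cmod (\<phi> t))\<^sup>2 / (2 * pi * ((cmod (\<phi> t))\<^sup>2)\<^sup>2)"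
    unfolding inversion_factor_above[of \<alpha> t s \<phi>, OF True] norm_divide norm_of_real complex_mod_cnj power_divide
    by (simp add: power_mult_distrib)
  also have "\<dots> = 1 / (2 * pi * (cmod (\<phi> t))\<^sup>2)"
    using \<phi> by (simp add: power2_eq_square)
  finally have "(1 + t\<^sup>2) powr s * (cmod (inversion_factor \<phi> s \<alpha> t))\<^sup>2
      = (1 + t\<^sup>2) powr s / (2 * pi * (cmod (\<phi> t))\<^sup>2)" by simp
  also have "\<dots> \<le> (1 + t\<^sup>2) powr s / (2 * pi * (\<alpha> * (1 + t\<^sup>2) powr s))"
    using True \<phi> \<alpha>w \<alpha> pos by (intro divide_left_mono mult_left_mono mult_pos_pos) auto
  also have "\<dots> = 1 / (2 * pi * \<alpha>)" using pos \<alpha> by simp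
  finally show ?thesis .
next
  case False
  then show ?thesis using \<alpha> by (simp add: inversion_factor_below)
qed

text \<open>Here \<open>\<psi>\<close> is the transform of the target and \<open>k\<close> that of the rescaled kernel, both at \<open>t\<close>. If the
  threshold is met, \<open>\<phi>\<close> cancels and the kernel condition produces \<open>(1 + t\<^sup>2) powr (p + a)\<close>, of which the
  target absorbs the exponent \<open>p\<close>; the remaining \<open>(1 + t\<^sup>2) powr (a + s)\<close> is bounded because \<open>\<phi>\<close> is both above
  the threshold and at most of order \<open>(1 + t\<^sup>2) powr (- a / 2)\<close>. If it fails, the error is \<open>- \<psi>\<close>, and
  the lower bound on \<open>\<phi>\<close> gives \<open>\<alpha> / d * (1 + t\<^sup>2) powr (a + s) \<ge> 1\<close>, a quantity whose power
  \<open>(p - s) / (a + s)\<close> may be multiplied in.\<close>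

lemma weighted_bias_bound:
  fixes \<phi> :: "real \<Rightarrow> complex" and \<psi> k :: complex
  assumes d: "d > 0" and smooth: "d \<le> (1 + t\<^sup>2) powr a * (cmod (\<phi> t))\<^sup>2"
      "(1 + t\<^sup>2) powr a * (cmod (\<phi> t))\<^sup>2 \<le> inverse d"
    and \<alpha>: "\<alpha> > 0" and h: "h > 0" and s: "0 \<le> s" "s < p" and a: "a > 0"
    and C: "C \<ge> 0" and k: "cmod (1 - complex_of_real (sqrt (2 * pi)) * k) \<le> C * (h * \<bar>t\<bar>) powr (p + a)"
  shows "(1 + t\<^sup>2) powr s * (cmod (complex_of_real (2 * pi) * (\<psi> * \<phi> t) * (k * inversion_factor \<phi> s \<alpha> t) - \<psi>))\<^sup>2
    \<le> (C\<^sup>2 * h powr (2 * (p + a)) / (d * \<alpha>) + (\<alpha> / d) powr ((p - s) / (a + s)))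
      * ((1 + t\<^sup>2) powr p * (cmod \<psi>)\<^sup>2)"
proof -
  define w where "w = 1 + t\<^sup>2"
  have w: "w > 0" by (simp add: w_def add_pos_nonneg)
  define F where "F = (cmod (\<phi> t))\<^sup>2"
  note smooth = smooth[folded w_def F_def]
  have Fpos: "F > 0" using smooth(1) d w by (smt (verit) mult_nonneg_nonpos powr_ge_zero)
  show ?thesis
  proof (cases "\<alpha> * w powr s \<le> F")
    case True
    then have m: "inversion_factor \<phi> s \<alpha> t = cnj (\<phi> t) / complex_of_real (sqrt (2 * pi) * F)"
      unfolding w_def F_def by (rule inversion_factor_above)
    have \<phi>\<phi>: "complex_of_real F = \<phi> t * cnj (\<phi> t)"
      unfolding F_def by (rule complex_norm_square)
    have reorder: "u * (\<psi> * x) * (k * (y / q)) = u * \<psi> * k * ((x * y) / q)" for u x y q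
      by simp
    have "complex_of_real (2 * pi) * (\<psi> * \<phi> t) * (k * inversion_factor \<phi> s \<alpha> t)
        = complex_of_real (2 * pi) * \<psi> * k * (complex_of_real F / complex_of_real (sqrt (2 * pi) * F))"
      unfolding m reorder \<phi>\<phi>[symmetric] ..
    also have "\<dots> = complex_of_real (2 * pi / sqrt (2 * pi)) * \<psi> * k"
      using Fpos by simp
    also have "2 * pi / sqrt (2 * pi) = sqrt (2 * pi)"
      by (rule real_div_sqrt) simp
    finally have prod: "complex_of_real (2 * pi) * (\<psi> * \<phi> t) * (k * inversion_factor \<phi> s \<alpha> t)
        = complex_of_real (sqrt (2 * pi)) * \<psi> * k" .
    have "cmod (complex_of_real (2 * pi) * (\<psi> * \<phi> t) * (k * inversion_factor \<phi> s \<alpha> t) - \<psi>)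
        = cmod (- (\<psi> * (1 - complex_of_real (sqrt (2 * pi)) * k)))"
      unfolding prod by (rule arg_cong[where f = cmod]) (simp add: algebra_simps)
    also have "\<dots> = cmod \<psi> * cmod (1 - complex_of_real (sqrt (2 * pi)) * k)"
      by (simp only: norm_minus_cancel norm_mult)
    finally have eq: "(cmod (complex_of_real (2 * pi) * (\<psi> * \<phi> t) * (k * inversion_factor \<phi> s \<alpha> t) - \<psi>))\<^sup>2
        = (cmod \<psi>)\<^sup>2 * (cmod (1 - complex_of_real (sqrt (2 * pi)) * k))\<^sup>2"
      by (simp add: power_mult_distrib)
    have "(cmod (1 - complex_of_real (sqrt (2 * pi)) * k))\<^sup>2 \<le> (C * (h * \<bar>t\<bar>) powr (p + a))\<^sup>2"
      by (intro power_mono k) simp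
    also have "\<dots> = C\<^sup>2 * (h * \<bar>t\<bar>) powr (2 * (p + a))"
      unfolding power_mult_distrib power2_eq_square[of "_ powr _"] powr_add[symmetric] by (simp only: mult_2)
    also have "\<dots> = C\<^sup>2 * h powr (2 * (p + a)) * (\<bar>t\<bar> powr 2) powr (p + a)"
      using h unfolding powr_powr by (simp add: powr_mult)
    also have "\<dots> \<le> C\<^sup>2 * h powr (2 * (p + a)) * w powr (p + a)"
    proof -
      have "\<bar>t\<bar> powr 2 \<le> w" by (simp add: w_def)
      then show ?thesis using s a by (intro mult_left_mono powr_mono2) auto
    qed
    finally have kb: "(cmod (1 - complex_of_real (sqrt (2 * pi)) * k))\<^sup>2 \<le> C\<^sup>2 * h powr (2 * (p + a)) * w powr (p + a)" .
    have "\<alpha> * w powr (a + s) = w powr a * (\<alpha> * w powr s)" by (simp add: powr_add mult_ac)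
    also have "\<dots> \<le> w powr a * F" using True by (intro mult_left_mono) auto
    also have "\<dots> \<le> inverse d" by (rule smooth)
    finally have wb: "w powr (a + s) \<le> 1 / (d * \<alpha>)"
      using \<alpha> d by (simp add: field_simps)
    have "w powr s * ((cmod \<psi>)\<^sup>2 * (cmod (1 - complex_of_real (sqrt (2 * pi)) * k))\<^sup>2)
        \<le> w powr s * ((cmod \<psi>)\<^sup>2 * (C\<^sup>2 * h powr (2 * (p + a)) * w powr (p + a)))"
      by (intro mult_left_mono kb) auto
    also have "\<dots> = C\<^sup>2 * h powr (2 * (p + a)) * (w powr p * (cmod \<psi>)\<^sup>2) * w powr (a + s)"
      by (simp add: powr_add mult_ac)
    also have "\<dots> \<le> C\<^sup>2 * h powr (2 * (p + a)) * (w powr p * (cmod \<psi>)\<^sup>2) * (1 / (d * \<alpha>))"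
      by (intro mult_left_mono wb) auto
    also have "\<dots> = C\<^sup>2 * h powr (2 * (p + a)) / (d * \<alpha>) * (w powr p * (cmod \<psi>)\<^sup>2)" by simp
    also have "\<dots> \<le> (C\<^sup>2 * h powr (2 * (p + a)) / (d * \<alpha>) + (\<alpha> / d) powr ((p - s) / (a + s))) * (w powr p * (cmod \<psi>)\<^sup>2)"
      by (intro mult_right_mono) auto
    finally show ?thesis unfolding eq w_def[symmetric] .
  next
    case False
    then have m: "inversion_factor \<phi> s \<alpha> t = 0"
      unfolding w_def F_def by (rule inversion_factor_below)
    let ?\<theta> = "(p - s) / (a + s)"
    have "d \<le> w powr a * F" by (rule smooth)
    also have "\<dots> \<le> w powr a * (\<alpha> * w powr s)" using False by (intro mult_left_mono) auto
    also have "\<dots> = \<alpha> * w powr (a + s)" by (simp add: powr_add mult_ac)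
    finally have "1 \<le> \<alpha> / d * w powr (a + s)"
      using d by (simp add: field_simps)
    then have "1 powr ?\<theta> \<le> (\<alpha> / d * w powr (a + s)) powr ?\<theta>"
      using s a by (intro powr_mono2) auto
    also have "\<dots> = (\<alpha> / d) powr ?\<theta> * w powr (p - s)"
    proof -
      have "(\<alpha> / d * w powr (a + s)) powr ?\<theta> = (\<alpha> / d) powr ?\<theta> * (w powr (a + s)) powr ?\<theta>"
        by (rule powr_mult)
      then show ?thesis using s a by (simp add: powr_powr)
    qed
    finally have one: "1 \<le> (\<alpha> / d) powr ?\<theta> * w powr (p - s)" by simp
    have "w powr s * (cmod \<psi>)\<^sup>2 * 1 \<le> w powr s * (cmod \<psi>)\<^sup>2 * ((\<alpha> / d) powr ?\<theta> * w powr (p - s))"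
      by (intro mult_left_mono one) auto
    also have "\<dots> = (\<alpha> / d) powr ?\<theta> * ((w powr s * w powr (p - s)) * (cmod \<psi>)\<^sup>2)" by (simp add: mult_ac)
    also have "w powr s * w powr (p - s) = w powr p" by (simp flip: powr_add)
    also have "(\<alpha> / d) powr ?\<theta> * (w powr p * (cmod \<psi>)\<^sup>2)
      \<le> (C\<^sup>2 * h powr (2 * (p + a)) / (d * \<alpha>) + (\<alpha> / d) powr ?\<theta>) * (w powr p * (cmod \<psi>)\<^sup>2)"
      using d \<alpha> by (intro mult_right_mono) auto
    finally show ?thesis by (simp add: m w_def)
  qed
qed

text \<open>The prescribed transform is square integrable, because the threshold bounds the division, and it
  has bounded support, because \<open>\<phi>\<close> falls below the threshold for large \<open>t\<close>. So it lies in \<open>L1\<close> as well and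
  is a transform, which makes the choice in the definition of the estimator effective.\<close>

lemma deconvolution_estimator_fourier:
  fixes f\<epsilon> :: "real \<Rightarrow> real"
  defines "\<phi> \<equiv> fourier (\<lambda>x. complex_of_real (f\<epsilon> x))"
  assumes f\<epsilon>: "f\<epsilon> \<in> densities_L2" and d: "d > 0"
    and smooth: "\<And>t. (1 + t\<^sup>2) powr a * (cmod (\<phi> t))\<^sup>2 \<le> inverse d"
    and a: "a > 1 / 2" and s: "s \<ge> 0" and \<alpha>: "\<alpha> > 0" and h: "h > 0"
    and K: "K \<in> L1" "K \<in> L2"
  shows "deconvolution_estimator K f\<epsilon> s h \<alpha> n y \<in> L2" (is ?in)
    and "AE t in lborel. fourier (deconvolution_estimator K f\<epsilon> s h \<alpha> n y) t
      = fourier (kernel_estimator K h n y) t * inversion_factor \<phi> s \<alpha> t" (is ?eq)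
proof -
  have \<phi>: "\<phi> = fourier_integral (\<lambda>x. complex_of_real (f\<epsilon> x))"
    using densities_L2D[OF f\<epsilon>] by (simp add: \<phi>_def fourier_def)
  have [measurable]: "\<phi> \<in> borel_measurable borel"
    unfolding \<phi> using densities_L2D(5)[OF f\<epsilon>] by measurable
  have FK: "fourier K = fourier_integral K" using K by (simp add: fourier_def)
  have FKL2: "fourier_integral K \<in> L2" by (rule fourier_integral_L2[OF K])
  note [measurable] = L2_measurable[OF FKL2]
  define R where "R t = fourier (kernel_estimator K h n y) t * inversion_factor \<phi> s \<alpha> t" for t
  have Rdef: "R t = (\<Sum>j=1..n. cis (- (t * y j))) / of_nat n * fourier_integral K (- (h * t)) * inversion_factor \<phi> s \<alpha> t" for t
    unfolding R_def fourier_kernel_estimator[OF K(1) h] FK ..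
  have Rm [measurable]: "R \<in> borel_measurable borel"
    unfolding Rdef[abs_def] by measurable
  have "integrable lborel (\<lambda>t. (cmod (fourier_integral K (- (h * t))))\<^sup>2 * (1 / (2 * pi * \<alpha>)))"
    using lborel_integrable_real_affine[OF L2_integrable[OF FKL2], of "- h" 0] h by simp
  then have "integrable lborel (\<lambda>t. (cmod (R t))\<^sup>2)"
  proof (rule Bochner_Integration.integrable_bound)
    have "(cmod (R t))\<^sup>2 \<le> (cmod (fourier_integral K (- (h * t))))\<^sup>2 * (1 / (2 * pi * \<alpha>))" for t
    proof -
      have "cmod (\<Sum>j=1..n. cis (- (t * y j))) \<le> (\<Sum>j=1..n. 1)"
        by (intro order_trans[OF norm_sum] sum_mono) simp
      then have "cmod ((\<Sum>j=1..n. cis (- (t * y j))) / of_nat n) \<le> 1"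
        by (cases "n = 0") (auto simp: norm_divide divide_le_eq)
      then have "(cmod ((\<Sum>j=1..n. cis (- (t * y j))) / of_nat n))\<^sup>2 \<le> 1"
        by (simp add: power_le_one)
      moreover have "(cmod (inversion_factor \<phi> s \<alpha> t))\<^sup>2 \<le> 1 / (2 * pi * \<alpha>)"
      proof -
        have "1 \<le> (1 + t\<^sup>2) powr s" using s by (intro ge_one_powr_ge_zero) auto
        then have "1 * (cmod (inversion_factor \<phi> s \<alpha> t))\<^sup>2 \<le> (1 + t\<^sup>2) powr s * (cmod (inversion_factor \<phi> s \<alpha> t))\<^sup>2"
          by (rule mult_right_mono) simp
        then show ?thesis using inversion_factor_weighted_bound[OF \<alpha>, of t s \<phi>] by simp
      qed
      ultimately have "((cmod ((\<Sum>j=1..n. cis (- (t * y j))) / of_nat n))\<^sup>2 * (cmod (fourier_integral K (- (h * t))))\<^sup>2)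
          * (cmod (inversion_factor \<phi> s \<alpha> t))\<^sup>2
          \<le> (1 * (cmod (fourier_integral K (- (h * t))))\<^sup>2) * (1 / (2 * pi * \<alpha>))"
        by (intro mult_mono) auto
      then show ?thesis unfolding Rdef by (simp only: norm_mult power_mult_distrib mult_1_left)
    qed
    then show "AE t in lborel. norm ((cmod (R t))\<^sup>2) \<le> norm ((cmod (fourier_integral K (- (h * t))))\<^sup>2 * (1 / (2 * pi * \<alpha>)))"
      using \<alpha> by (intro AE_I2) (simp add: abs_mult)
  qed measurable
  then have R2: "R \<in> L2" by (simp add: L2_def)
  have supp: "R t = indicator {- (1 / (d * \<alpha>))..1 / (d * \<alpha>)} t * R t" for t
  proof (cases "\<alpha> * (1 + t\<^sup>2) powr s \<le> (cmod (\<phi> t))\<^sup>2")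
    case True
    have w: "1 \<le> 1 + t\<^sup>2" by simp
    \<comment> \<open>As \<open>a > 1 / 2\<close>, already \<open>|t|\<close> is at most \<open>(1 + t\<^sup>2) powr (a + s)\<close>.\<close>
    have "\<bar>t\<bar> = (t\<^sup>2) powr (1 / 2)" by (simp add: powr_half_sqrt)
    also have "\<dots> \<le> (1 + t\<^sup>2) powr (1 / 2)" by (intro powr_mono2) auto
    also have "\<dots> \<le> (1 + t\<^sup>2) powr (a + s)" using a s w by (intro powr_mono) auto
    finally have "\<alpha> * \<bar>t\<bar> \<le> \<alpha> * (1 + t\<^sup>2) powr (a + s)" using \<alpha> by simp
    also have "\<dots> = (1 + t\<^sup>2) powr a * (\<alpha> * (1 + t\<^sup>2) powr s)" by (simp add: powr_add mult_ac)
    also have "\<dots> \<le> (1 + t\<^sup>2) powr a * (cmod (\<phi> t))\<^sup>2" using True by (intro mult_left_mono) auto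
    also have "\<dots> \<le> inverse d" by (rule smooth)
    finally have "\<bar>t\<bar> \<le> 1 / (d * \<alpha>)" using d \<alpha> by (simp add: field_simps)
    then show ?thesis by (auto simp: abs_le_iff indicator_def)
  next
    case False
    then show ?thesis by (simp add: R_def inversion_factor_below)
  qed
  have R1: "R \<in> L1"
    using L1_cutoff_interval[OF R2, of "1 / (d * \<alpha>)"] supp by simp
  obtain g where g: "g \<in> L2" "AE t in lborel. fourier g t = R t"
    using fourier_surj[OF R1 R2] .
  let ?P = "\<lambda>g. g \<in> L2 \<and> (AE t in lborel. fourier g t = R t)"
  have "deconvolution_estimator K f\<epsilon> s h \<alpha> n y = (SOME g. ?P g)"
    unfolding deconvolution_estimator_def Let_def R_def inversion_factor_def \<phi>_def
    by (simp only: mult.assoc times_divide_eq_right[symmetric] )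
  moreover have "?P (SOME g. ?P g)" using g by (intro someI[of ?P g]) blast
  ultimately have "?P (deconvolution_estimator K f\<epsilon> s h \<alpha> n y)" by simp
  then show ?in ?eq by (simp_all add: R_def)
qed

section \<open>The risk and its rate\<close>

text \<open>The first term bounds the fluctuation of the empirical transform, the other two the squared bias
  above and below the threshold. The factor 2 comes from splitting the square of a sum.\<close>

lemma risk_bound:
  fixes M :: "'a measure" and Y :: "nat \<Rightarrow> 'a \<Rightarrow> real" and fX f\<epsilon> :: "real \<Rightarrow> real" and K :: "real \<Rightarrow> complex"
  defines "\<phi> \<equiv> fourier (\<lambda>x. complex_of_real (f\<epsilon> x))"
  assumes M: "prob_space M" and fX: "fX \<in> densities_L2" and f\<epsilon>: "f\<epsilon> \<in> densities_L2"
    and Y: "\<And>j. j \<ge> 1 \<Longrightarrow> distributed M lborel (Y j) (\<lambda>y. ennreal (density_convolution fX f\<epsilon> y))"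
    and indep: "prob_space.indep_vars M (\<lambda>_. borel) Y {1..}"
    and fXp: "(\<lambda>x. complex_of_real (fX x)) \<in> sobolev p"
    and d: "d > 0" and smooth: "\<And>t. d \<le> (1 + t\<^sup>2) powr a * (cmod (\<phi> t))\<^sup>2"
      "\<And>t. (1 + t\<^sup>2) powr a * (cmod (\<phi> t))\<^sup>2 \<le> inverse d"
    and a: "a > 1 / 2" and s: "0 \<le> s" "s < p"
    and K: "K \<in> L1" "K \<in> L2" and C: "C \<ge> 0"
    and kernel: "\<And>t. t \<noteq> 0 \<Longrightarrow> cmod (1 - complex_of_real (sqrt (2 * pi)) * fourier K t) \<le> C * \<bar>t\<bar> powr (p + a)"
    and h: "h > 0" and \<alpha>: "\<alpha> > 0" and n: "n \<ge> 1"
  shows "(\<integral>\<^sup>+\<omega>. sobolev_norm_sq s (\<lambda>x. deconvolution_estimator K f\<epsilon> s h \<alpha> n (\<lambda>j. Y j \<omega>) x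
        - complex_of_real (fX x)) \<partial>M)
    \<le> ennreal (sq_norm K / (pi * \<alpha> * real n * h)
        + 2 * (C\<^sup>2 * h powr (2 * (p + a)) / (d * \<alpha>) + (\<alpha> / d) powr ((p - s) / (a + s)))
            * enn2real (sobolev_norm_sq p (\<lambda>x. complex_of_real (fX x))))"
proof -
  interpret prob_space M by (rule M)
  interpret pair_sigma_finite M lborel ..
  define \<psi> where "\<psi> = fourier (\<lambda>x. complex_of_real (fX x))"
  define A where "A \<omega> t = (\<Sum>j=1..n. cis (- (t * Y j \<omega>))) / of_nat n" for \<omega> t
  define k where "k t = fourier K (- (h * t))" for t
  define m where "m = inversion_factor \<phi> s \<alpha>"
  define \<mu> where "\<mu> t = complex_of_real (2 * pi) * (\<psi> t * \<phi> t)" for t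
  define B where "B = C\<^sup>2 * h powr (2 * (p + a)) / (d * \<alpha>) + (\<alpha> / d) powr ((p - s) / (a + s))"
  have B: "B \<ge> 0" unfolding B_def using d \<alpha> by (intro add_nonneg_nonneg divide_nonneg_pos) auto
  have fXL2: "(\<lambda>x. complex_of_real (fX x)) \<in> L2" using densities_L2D[OF fX] by simp
  have FK: "fourier K = fourier_integral K" using K by (simp add: fourier_def)
  have FKL2: "fourier K \<in> L2" "sq_norm (fourier K) = sq_norm K"
    unfolding FK by (rule fourier_integral_L2[OF K] plancherel[OF K])+
  have [measurable]: "\<psi> \<in> borel_measurable borel" "\<phi> \<in> borel_measurable borel"
    using densities_L2D[OF fX] densities_L2D[OF f\<epsilon>] by (auto simp: \<psi>_def \<phi>_def fourier_def)
  note [measurable] = L2_measurable[OF FKL2(1)]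
  have [measurable]: "k \<in> borel_measurable borel" "m \<in> borel_measurable borel"
    by (simp_all add: k_def[abs_def] m_def)
  have Ym: "Y j \<in> borel_measurable M" if "j \<in> {1..n}" for j
    using distributed_measurable[OF Y[of j]] that by simp
  have Am: "(\<lambda>(\<omega>, t). A \<omega> t) \<in> borel_measurable (M \<Otimes>\<^sub>M lborel)"
  proof -
    have "(\<lambda>x. cis (- (snd x * Y j (fst x)))) \<in> borel_measurable (M \<Otimes>\<^sub>M lborel)" if "j \<in> {1..n}" for j
      using Ym[OF that] by measurable
    then show ?thesis
      unfolding A_def split_beta' by (intro borel_measurable_divide borel_measurable_sum) auto
  qed
  have mean: "expectation (\<lambda>\<omega>. cis (- (t * Y j \<omega>))) = \<mu> t" if "j \<ge> 1" for j t
    using expectation_cis_convolution[OF fX f\<epsilon> Y[OF that]] by (simp add: \<mu>_def \<psi>_def \<phi>_def)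
  have mse: "expectation (\<lambda>\<omega>. (cmod (A \<omega> t - \<mu> t))\<^sup>2) \<le> 1 / real n" for t
    using mean_square_deviation_of_sample_mean[OF indep, of "\<lambda>y. cis (- (t * y))"] mean n
    by (simp add: A_def)
  have A1: "cmod (A \<omega> t) \<le> 1" for \<omega> t
  proof -
    have "cmod (\<Sum>j=1..n. cis (- (t * Y j \<omega>))) \<le> (\<Sum>j=1..n. 1)"
      by (intro order_trans[OF norm_sum] sum_mono) simp
    then show ?thesis using n by (simp add: A_def norm_divide divide_le_eq)
  qed
  have mse_int: "integrable M (\<lambda>\<omega>. (cmod (A \<omega> t - \<mu> t))\<^sup>2)" for t
  proof (rule integrable_const_bound[of _ "2 + 2 * (cmod (\<mu> t))\<^sup>2"])
    show "AE \<omega> in M. norm ((cmod (A \<omega> t - \<mu> t))\<^sup>2) \<le> 2 + 2 * (cmod (\<mu> t))\<^sup>2"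
    proof (rule AE_I2)
      fix \<omega>
      have "(cmod (A \<omega> t))\<^sup>2 \<le> 1" using A1 by (simp add: power_le_one)
      then show "norm ((cmod (A \<omega> t - \<mu> t))\<^sup>2) \<le> 2 + 2 * (cmod (\<mu> t))\<^sup>2"
        using norm_diff_sq_le[of "A \<omega> t" "\<mu> t"] by simp
    qed
    have "(\<lambda>\<omega>. A \<omega> t) \<in> borel_measurable M"
      using measurable_compose[OF measurable_Pair2'[of t lborel M] Am] by simp
    then show "(\<lambda>\<omega>. (cmod (A \<omega> t - \<mu> t))\<^sup>2) \<in> borel_measurable M" by measurable
  qed
  have loss: "sobolev_norm_sq s (\<lambda>x. deconvolution_estimator K f\<epsilon> s h \<alpha> n (\<lambda>j. Y j \<omega>) x - complex_of_real (fX x))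
      = (\<integral>\<^sup>+t. ennreal ((1 + t\<^sup>2) powr s * (cmod (A \<omega> t * k t * m t - \<psi> t))\<^sup>2) \<partial>lborel)" for \<omega>
  proof -
    note est = deconvolution_estimator_fourier[OF f\<epsilon> d smooth(2)[unfolded \<phi>_def] a s(1) \<alpha> h K, of n "\<lambda>j. Y j \<omega>", folded \<phi>_def]
    show ?thesis
      unfolding sobolev_norm_sq_def
    proof (rule nn_integral_cong_AE)
      show "AE t in lborel. ennreal ((1 + t\<^sup>2) powr s * (cmod (fourier (\<lambda>x. deconvolution_estimator K f\<epsilon> s h \<alpha> n (\<lambda>j. Y j \<omega>) x - complex_of_real (fX x)) t))\<^sup>2)
        = ennreal ((1 + t\<^sup>2) powr s * (cmod (A \<omega> t * k t * m t - \<psi> t))\<^sup>2)"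
        using fourier_diff_AE[OF est(1) fXL2] est(2)
        by eventually_elim (simp add: fourier_kernel_estimator[OF K(1) h] A_def k_def m_def \<psi>_def)
    qed
  qed
  have pointwise: "(\<integral>\<^sup>+\<omega>. ennreal ((1 + t\<^sup>2) powr s * (cmod (A \<omega> t * k t * m t - \<psi> t))\<^sup>2) \<partial>M)
      \<le> ennreal ((cmod (k t))\<^sup>2 * (1 / (pi * \<alpha> * real n)) + 2 * B * ((1 + t\<^sup>2) powr p * (cmod (\<psi> t))\<^sup>2))"
    if t: "t \<noteq> 0" for t
  proof -
    let ?w = "1 + t\<^sup>2"
    have bias: "?w powr s * (cmod (\<mu> t * (k t * m t) - \<psi> t))\<^sup>2 \<le> B * (?w powr p * (cmod (\<psi> t))\<^sup>2)"
      unfolding \<mu>_def m_def B_def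
    proof (rule weighted_bias_bound[OF d smooth \<alpha> h s _ C])
      show "cmod (1 - complex_of_real (sqrt (2 * pi)) * k t) \<le> C * (h * \<bar>t\<bar>) powr (p + a)"
        using kernel[of "- (h * t)"] t h by (simp add: k_def abs_mult)
    qed (use a in simp)
    have ptw: "?w powr s * (cmod (A \<omega> t * k t * m t - \<psi> t))\<^sup>2
        \<le> (cmod (k t))\<^sup>2 / (pi * \<alpha>) * (cmod (A \<omega> t - \<mu> t))\<^sup>2 + 2 * B * (?w powr p * (cmod (\<psi> t))\<^sup>2)" for \<omega>
    proof -
      have split: "A \<omega> t * k t * m t - \<psi> t = (A \<omega> t - \<mu> t) * k t * m t - (\<psi> t - \<mu> t * (k t * m t))"
        by (simp add: algebra_simps)
      have "(cmod (A \<omega> t * k t * m t - \<psi> t))\<^sup>2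
          \<le> 2 * (cmod ((A \<omega> t - \<mu> t) * k t * m t))\<^sup>2 + 2 * (cmod (\<mu> t * (k t * m t) - \<psi> t))\<^sup>2"
        unfolding split norm_minus_commute[of "\<mu> t * (k t * m t)"] by (rule norm_diff_sq_le)
      then have "?w powr s * (cmod (A \<omega> t * k t * m t - \<psi> t))\<^sup>2
          \<le> ?w powr s * (2 * (cmod ((A \<omega> t - \<mu> t) * k t * m t))\<^sup>2 + 2 * (cmod (\<mu> t * (k t * m t) - \<psi> t))\<^sup>2)"
        by (rule mult_left_mono) simp
      also have "\<dots> = 2 * ((cmod (A \<omega> t - \<mu> t))\<^sup>2 * (cmod (k t))\<^sup>2) * (?w powr s * (cmod (m t))\<^sup>2)
          + 2 * (?w powr s * (cmod (\<mu> t * (k t * m t) - \<psi> t))\<^sup>2)"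
        unfolding norm_mult power_mult_distrib distrib_left by (simp add: mult_ac)
      also have "\<dots> \<le> 2 * ((cmod (A \<omega> t - \<mu> t))\<^sup>2 * (cmod (k t))\<^sup>2) * (1 / (2 * pi * \<alpha>))
          + 2 * (B * (?w powr p * (cmod (\<psi> t))\<^sup>2))"
        using inversion_factor_weighted_bound[OF \<alpha>, of t s \<phi>] bias
        by (intro add_mono mult_left_mono) (auto simp: m_def)
      finally show ?thesis by (simp add: mult_ac)
    qed
    have "(\<integral>\<^sup>+\<omega>. ennreal (?w powr s * (cmod (A \<omega> t * k t * m t - \<psi> t))\<^sup>2) \<partial>M)
        \<le> (\<integral>\<^sup>+\<omega>. ennreal ((cmod (k t))\<^sup>2 / (pi * \<alpha>) * (cmod (A \<omega> t - \<mu> t))\<^sup>2 + 2 * B * (?w powr p * (cmod (\<psi> t))\<^sup>2)) \<partial>M)"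
      by (intro nn_integral_mono ennreal_leI ptw)
    also have "\<dots> = ennreal (expectation (\<lambda>\<omega>. (cmod (k t))\<^sup>2 / (pi * \<alpha>) * (cmod (A \<omega> t - \<mu> t))\<^sup>2 + 2 * B * (?w powr p * (cmod (\<psi> t))\<^sup>2)))"
    proof (rule nn_integral_eq_integral)
      show "integrable M (\<lambda>\<omega>. (cmod (k t))\<^sup>2 / (pi * \<alpha>) * (cmod (A \<omega> t - \<mu> t))\<^sup>2 + 2 * B * (?w powr p * (cmod (\<psi> t))\<^sup>2))"
        by (intro Bochner_Integration.integrable_add integrable_mult_right mse_int integrable_const)
    qed (use B \<alpha> in auto)
    also have "expectation (\<lambda>\<omega>. (cmod (k t))\<^sup>2 / (pi * \<alpha>) * (cmod (A \<omega> t - \<mu> t))\<^sup>2 + 2 * B * (?w powr p * (cmod (\<psi> t))\<^sup>2))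
        = (cmod (k t))\<^sup>2 / (pi * \<alpha>) * expectation (\<lambda>\<omega>. (cmod (A \<omega> t - \<mu> t))\<^sup>2) + 2 * B * (?w powr p * (cmod (\<psi> t))\<^sup>2)"
      by (subst Bochner_Integration.integral_add) (use mse_int in \<open>auto simp: prob_space\<close>)
    also have "\<dots> \<le> (cmod (k t))\<^sup>2 / (pi * \<alpha>) * (1 / real n) + 2 * B * (?w powr p * (cmod (\<psi> t))\<^sup>2)"
      using \<alpha> by (intro add_right_mono mult_left_mono mse) auto
    finally show ?thesis by (simp add: ennreal_leI)
  qed
  have variance_part: "(\<integral>\<^sup>+t. ennreal ((cmod (k t))\<^sup>2 * (1 / (pi * \<alpha> * real n))) \<partial>lborel)
      = ennreal (sq_norm K / (pi * \<alpha> * real n * h))"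
  proof -
    have "integrable lborel (\<lambda>t. (cmod (k t))\<^sup>2)"
      using lborel_integrable_real_affine[OF L2_integrable[OF FKL2(1)], of "- h" 0] h by (simp add: k_def)
    then have "(\<integral>\<^sup>+t. ennreal ((cmod (k t))\<^sup>2 * (1 / (pi * \<alpha> * real n))) \<partial>lborel)
        = ennreal ((LINT t|lborel. (cmod (k t))\<^sup>2) * (1 / (pi * \<alpha> * real n)))"
      using \<alpha> by (subst nn_integral_eq_integral) auto
    also have "(LINT t|lborel. (cmod (k t))\<^sup>2) = sq_norm K / h"
      using lborel_integral_real_affine[of "- h" "\<lambda>t. (cmod (fourier K t))\<^sup>2" 0] h FKL2(2)
      by (simp add: k_def sq_norm_def field_simps)
    finally show ?thesis by (simp add: mult_ac)
  qed
  have bias_part: "(\<integral>\<^sup>+t. ennreal (2 * B * ((1 + t\<^sup>2) powr p * (cmod (\<psi> t))\<^sup>2)) \<partial>lborel)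
      = ennreal (2 * B * enn2real (sobolev_norm_sq p (\<lambda>x. complex_of_real (fX x))))"
  proof -
    have "(\<integral>\<^sup>+t. ennreal (2 * B * ((1 + t\<^sup>2) powr p * (cmod (\<psi> t))\<^sup>2)) \<partial>lborel)
        = ennreal (2 * B) * sobolev_norm_sq p (\<lambda>x. complex_of_real (fX x))"
      unfolding sobolev_norm_sq_def \<psi>_def[symmetric]
      using B by (subst ennreal_mult) (auto simp: nn_integral_cmult)
    also have "sobolev_norm_sq p (\<lambda>x. complex_of_real (fX x))
        = ennreal (enn2real (sobolev_norm_sq p (\<lambda>x. complex_of_real (fX x))))"
      using fXp by (simp add: sobolev_def)
    finally show ?thesis using B by (simp add: ennreal_mult)
  qed
  have "(\<integral>\<^sup>+\<omega>. sobolev_norm_sq s (\<lambda>x. deconvolution_estimator K f\<epsilon> s h \<alpha> n (\<lambda>j. Y j \<omega>) x - complex_of_real (fX x)) \<partial>M)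
      = (\<integral>\<^sup>+t. \<integral>\<^sup>+\<omega>. ennreal ((1 + t\<^sup>2) powr s * (cmod (A \<omega> t * k t * m t - \<psi> t))\<^sup>2) \<partial>M \<partial>lborel)"
    unfolding loss
  proof (rule Fubini'[symmetric])
    note [measurable] = Am[unfolded split_beta']
    show "(\<lambda>(\<omega>, t). ennreal ((1 + t\<^sup>2) powr s * (cmod (A \<omega> t * k t * m t - \<psi> t))\<^sup>2)) \<in> borel_measurable (M \<Otimes>\<^sub>M lborel)"
      unfolding split_beta' by measurable
  qed
  also have "\<dots> \<le> (\<integral>\<^sup>+t. ennreal ((cmod (k t))\<^sup>2 * (1 / (pi * \<alpha> * real n)) + 2 * B * ((1 + t\<^sup>2) powr p * (cmod (\<psi> t))\<^sup>2)) \<partial>lborel)"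
    by (intro nn_integral_mono_AE) (use AE_lborel_singleton[of 0] pointwise in auto)
  also have "\<dots> = (\<integral>\<^sup>+t. ennreal ((cmod (k t))\<^sup>2 * (1 / (pi * \<alpha> * real n))) + ennreal (2 * B * ((1 + t\<^sup>2) powr p * (cmod (\<psi> t))\<^sup>2)) \<partial>lborel)"
    using B \<alpha> by (intro nn_integral_cong ennreal_plus) auto
  also have "\<dots> = ennreal (sq_norm K / (pi * \<alpha> * real n * h))
      + ennreal (2 * B * enn2real (sobolev_norm_sq p (\<lambda>x. complex_of_real (fX x))))"
    unfolding variance_part[symmetric] bias_part[symmetric] by (rule nn_integral_add) measurable
  also have "\<dots> = ennreal (sq_norm K / (pi * \<alpha> * real n * h)
      + 2 * B * enn2real (sobolev_norm_sq p (\<lambda>x. complex_of_real (fX x))))"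
    using B \<alpha> h by (intro ennreal_plus[symmetric] divide_nonneg_nonneg mult_nonneg_nonneg) auto
  finally show ?thesis unfolding B_def .
qed

theorem corollary3p3:
  fixes M :: "'a measure" and X \<epsilon> :: "'a \<Rightarrow> real" and Y :: "nat \<Rightarrow> 'a \<Rightarrow> real"
    and fX f\<epsilon> :: "real \<Rightarrow> real" and K :: "real \<Rightarrow> complex"
    and a p s c c' :: real
  assumes "prob_space M"
    and "fX \<in> densities_L2" and "f\<epsilon> \<in> densities_L2"
    and "distributed M lborel X (\<lambda>x. ennreal (fX x))"
    and "distributed M lborel \<epsilon> (\<lambda>x. ennreal (f\<epsilon> x))"
    and "prob_space.indep_var M borel X borel \<epsilon>"
    and "\<And>t. (cmod (fourier (\<lambda>x. complex_of_real (f\<epsilon> x)) t))\<^sup>2 > 0"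
    and "\<And>j. j \<ge> 1 \<Longrightarrow> distributed M lborel (Y j) (\<lambda>y. ennreal (density_convolution fX f\<epsilon> y))"
    and "prob_space.indep_vars M (\<lambda>_. borel) Y {1..}"
    and "p > 0" and "(\<lambda>x. complex_of_real (fX x)) \<in> sobolev p"
    and "a > 1 / 2" and "ordinary_smooth a f\<epsilon>"
    and "K \<in> kernel_class (p + a)"
    and "c > 0" and "c' > 0"
    and "0 \<le> s" and "s < p"
  shows "\<exists>C>0. \<forall>\<^sub>F n in sequentially.
    (\<integral>\<^sup>+\<omega>. sobolev_norm_sq s (\<lambda>x.
        deconvolution_estimator K f\<epsilon> s
          (c * real n powr (- 1 / (2 * (p + a) + 1)))
          (c' * real n powr (- 2 * (a + s) / (2 * (p + a) + 1)))
          n (\<lambda>j. Y j \<omega>) x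
        - complex_of_real (fX x)) \<partial>M)
    \<le> ennreal (C * real n powr (- 2 * (p - s) / (2 * (a + p) + 1)))"
proof -
  obtain d where d: "d > 0" and smooth:
      "\<And>t. d \<le> (1 + t\<^sup>2) powr a * (cmod (fourier (\<lambda>x. complex_of_real (f\<epsilon> x)) t))\<^sup>2"
      "\<And>t. (1 + t\<^sup>2) powr a * (cmod (fourier (\<lambda>x. complex_of_real (f\<epsilon> x)) t))\<^sup>2 \<le> inverse d"
    using \<open>ordinary_smooth a f\<epsilon>\<close> unfolding ordinary_smooth_def by blast
  have K: "K \<in> L1" "K \<in> L2" using \<open>K \<in> kernel_class (p + a)\<close> by (auto simp: kernel_class_def)
  have "p + a \<ge> 0" using \<open>p > 0\<close> \<open>a > 1 / 2\<close> by simp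
  then obtain C where C: "C \<ge> 0" and kernel:
      "\<And>t. t \<noteq> 0 \<Longrightarrow> cmod (1 - complex_of_real (sqrt (2 * pi)) * fourier K t) \<le> C * \<bar>t\<bar> powr (p + a)"
    using kernel_class_global_bound[OF \<open>K \<in> kernel_class (p + a)\<close>] by blast
  define D where "D = 2 * (p + a) + 1"
  have D: "D > 0" using \<open>p > 0\<close> \<open>a > 1 / 2\<close> by (simp add: D_def)
  define N where "N = enn2real (sobolev_norm_sq p (\<lambda>x. complex_of_real (fX x)))"
  define c1 where "c1 = sq_norm K / (pi * c' * c)"
  define c2 where "c2 = C\<^sup>2 * c powr (2 * (p + a)) / (d * c') + (c' / d) powr ((p - s) / (a + s))"
  \<comment> \<open>The summand \<open>1\<close> makes the constant positive even if the other two vanish.\<close>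
  define C' where "C' = c1 + 2 * c2 * N + 1"
  have C': "C' > 0"
    unfolding C'_def c1_def c2_def N_def using d \<open>c > 0\<close> \<open>c' > 0\<close>
    by (intro add_nonneg_pos add_nonneg_nonneg mult_nonneg_nonneg divide_nonneg_nonneg) auto
  have "(\<integral>\<^sup>+\<omega>. sobolev_norm_sq s (\<lambda>x.
        deconvolution_estimator K f\<epsilon> s
          (c * real n powr (- 1 / (2 * (p + a) + 1)))
          (c' * real n powr (- 2 * (a + s) / (2 * (p + a) + 1)))
          n (\<lambda>j. Y j \<omega>) x
        - complex_of_real (fX x)) \<partial>M)
    \<le> ennreal (C' * real n powr (- 2 * (p - s) / (2 * (a + p) + 1)))" if n: "n \<ge> 1" for n
  proof -
    define h where "h = c * real n powr (- 1 / D)"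
    define \<alpha> where "\<alpha> = c' * real n powr (- 2 * (a + s) / D)"
    define \<rho> where "\<rho> = real n powr (- 2 * (p - s) / D)"
    have x: "real n > 0" using n by simp
    have h: "h > 0" and \<alpha>: "\<alpha> > 0" and \<rho>: "\<rho> > 0"
      using x \<open>c > 0\<close> \<open>c' > 0\<close> by (auto simp: h_def \<alpha>_def \<rho>_def)
    \<comment> \<open>All three terms are multiples of \<open>\<rho>\<close>; each reduces to an identity between exponents of \<open>n\<close>.\<close>
    have "\<alpha> * real n * h * \<rho> = c' * c * (real n powr (- 2 * (a + s) / D) * real n powr 1 * real n powr (- 1 / D) * \<rho>)"
      using x by (simp add: \<alpha>_def h_def)
    also have "real n powr (- 2 * (a + s) / D) * real n powr 1 * real n powr (- 1 / D) * \<rho>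
        = real n powr (- 2 * (a + s) / D + 1 + - 1 / D + - 2 * (p - s) / D)"
      unfolding \<rho>_def by (simp only: powr_add)
    also have "- 2 * (a + s) / D + 1 + - 1 / D + - 2 * (p - s) / D = 0"
      using D by (simp add: field_simps) (simp add: D_def algebra_simps)
    finally have "\<alpha> * real n * h * \<rho> = c' * c" using x by simp
    then have "c1 * \<rho> = sq_norm K / (pi * (\<alpha> * real n * h * \<rho>)) * \<rho>"
      by (simp add: c1_def mult.assoc)
    then have var: "sq_norm K / (pi * \<alpha> * real n * h) = c1 * \<rho>"
      using \<rho> by (simp add: mult.assoc)
    have "h powr (2 * (p + a)) = c powr (2 * (p + a)) * real n powr (- 1 / D * (2 * (p + a)))"
      unfolding h_def using \<open>c > 0\<close> by (simp add: powr_mult powr_powr)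
    also have "- 1 / D * (2 * (p + a)) = - 2 * (p - s) / D + - 2 * (a + s) / D"
      using D by (simp add: field_simps)
    also have "real n powr \<dots> = \<rho> * (\<alpha> / c')"
      unfolding powr_add \<rho>_def \<alpha>_def using \<open>c' > 0\<close> by simp
    finally have bias1: "C\<^sup>2 * h powr (2 * (p + a)) / (d * \<alpha>) = C\<^sup>2 * c powr (2 * (p + a)) / (d * c') * \<rho>"
      using \<alpha> by (simp add: mult_ac)
    have as: "a + s > 0" using \<open>a > 1 / 2\<close> \<open>0 \<le> s\<close> by simp
    have "(\<alpha> / d) powr ((p - s) / (a + s)) = (c' / d * real n powr (- 2 * (a + s) / D)) powr ((p - s) / (a + s))"
      unfolding \<alpha>_def by (simp only: times_divide_eq_left)
    also have "\<dots> = (c' / d) powr ((p - s) / (a + s)) * real n powr (- 2 * (a + s) / D * ((p - s) / (a + s)))"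
      unfolding powr_mult powr_powr ..
    also have "- 2 * (a + s) / D * ((p - s) / (a + s)) = - 2 * (p - s) / D"
    proof -
      have "- 2 * q / D * (r / q) = - 2 * r / D" if "q > 0" for q r using that by simp
      from this[OF as] show ?thesis .
    qed
    finally have bias2: "(\<alpha> / d) powr ((p - s) / (a + s)) = (c' / d) powr ((p - s) / (a + s)) * \<rho>"
      unfolding \<rho>_def .
    have "sq_norm K / (pi * \<alpha> * real n * h)
        + 2 * (C\<^sup>2 * h powr (2 * (p + a)) / (d * \<alpha>) + (\<alpha> / d) powr ((p - s) / (a + s))) * N
        = (c1 + 2 * c2 * N) * \<rho>"
      unfolding var bias1 bias2 c2_def by (simp add: algebra_simps)
    also have "\<dots> \<le> C' * \<rho>"
      using \<rho> by (intro mult_right_mono) (auto simp: C'_def)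
    finally have le: "ennreal (sq_norm K / (pi * \<alpha> * real n * h)
        + 2 * (C\<^sup>2 * h powr (2 * (p + a)) / (d * \<alpha>) + (\<alpha> / d) powr ((p - s) / (a + s))) * N) \<le> ennreal (C' * \<rho>)"
      by (rule ennreal_leI)
    have exps: "2 * (p + a) + 1 = D" "2 * (a + p) + 1 = D" by (simp_all add: D_def)
    show ?thesis
      unfolding exps h_def[symmetric] \<alpha>_def[symmetric] \<rho>_def[symmetric]
      by (rule order_trans[OF risk_bound[OF \<open>prob_space M\<close> \<open>fX \<in> densities_L2\<close> \<open>f\<epsilon> \<in> densities_L2\<close> assms(8)
        \<open>prob_space.indep_vars M (\<lambda>_. borel) Y {1..}\<close> assms(11) d smooth
        \<open>a > 1 / 2\<close> \<open>0 \<le> s\<close> \<open>s < p\<close> K C kernel h \<alpha> n] le[unfolded N_def]])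
  qed
  then have "\<forall>\<^sub>F n in sequentially. (\<integral>\<^sup>+\<omega>. sobolev_norm_sq s (\<lambda>x.
        deconvolution_estimator K f\<epsilon> s
          (c * real n powr (- 1 / (2 * (p + a) + 1)))
          (c' * real n powr (- 2 * (a + s) / (2 * (p + a) + 1)))
          n (\<lambda>j. Y j \<omega>) x
        - complex_of_real (fX x)) \<partial>M)
    \<le> ennreal (C' * real n powr (- 2 * (p - s) / (2 * (a + p) + 1)))"
    by (rule eventually_sequentiallyI)
  with C' show ?thesis by blast
qed

end
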